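(* For every $\eta>0$ there exists $C>0$ such that for every non-constant $f\colon\{0,1\}^n\to\{0,1\}$, \[ \sum_{S\subseteq[n]}\widehat f(S)^2\,\mathbf{1}\Big[|\widehat f(S)|\leq 2^{-C\cdot\tilde I[f]\log(1+\tilde I[f])}\Big]\leq \eta\cdot\mathrm{var}(f). \]
   Context: $\{0,1\}^n$ carries the uniform measure; $\chi_S(x)=(-1)^{\sum_{i\in S}x_i}$, $\widehat f(S)=\mathbb{E}_x[f(x)\chi_S(x)]$. The total influence is $I[f]=\sum_S|S|\widehat f(S)^2$, $\mathrm{var}(f)=\mathbb{E}[f^2]-\mathbb{E}[f]^2$, $\tilde I[f]=I[f]/\mathrm{var}(f)$. $\log$ is the natural logarithm. *)

theory Defs
  imports "HOL-Analysis.Analysis"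
begin

text \<open>Since the constant of the theorem must not depend on the dimension \<open>n\<close>, the cube is an explicit
  carrier set. A function on it is a real-valued function that is only ever
  evaluated at points of the carrier.\<close>

definition cube :: "nat \<Rightarrow> (nat \<Rightarrow> nat) set" where
  "cube n = {1..n} \<rightarrow>\<^sub>E {0, 1}"

definition expect :: "nat \<Rightarrow> ((nat \<Rightarrow> nat) \<Rightarrow> real) \<Rightarrow> real" where
  "expect n f = (\<Sum>x\<in>cube n. f x) / real (card (cube n))"

definition chi :: "nat set \<Rightarrow> (nat \<Rightarrow> nat) \<Rightarrow> real" where
  "chi S x = (- 1) ^ (\<Sum>i\<in>S. x i)"

definition fourier :: "nat \<Rightarrow> ((nat \<Rightarrow> nat) \<Rightarrow> real) \<Rightarrow> nat set \<Rightarrow> real" where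
  "fourier n f S = expect n (\<lambda>x. f x * chi S x)"

definition total_influence :: "nat \<Rightarrow> ((nat \<Rightarrow> nat) \<Rightarrow> real) \<Rightarrow> real" where
  "total_influence n f = (\<Sum>S\<in>Pow {1..n}. real (card S) * (fourier n f S)\<^sup>2)"

definition var :: "nat \<Rightarrow> ((nat \<Rightarrow> nat) \<Rightarrow> real) \<Rightarrow> real" where
  "var n f = expect n (\<lambda>x. (f x)\<^sup>2) - (expect n f)\<^sup>2"

definition norm_influence :: "nat \<Rightarrow> ((nat \<Rightarrow> nat) \<Rightarrow> real) \<Rightarrow> real" where
  "norm_influence n f = total_influence n f / var n f"

end

theory Submission
  imports Defs
begin

text \<open>
  Colour the coordinates with about \<open>m = I / (\<eta> var)\<close> colours. Once all coordinates outside one colour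
  class are fixed, the restricted function is still Boolean, so Friedgut's argument shows that its
  Fourier weight sits on few sets; this is the only place where Booleanness is essential. Classes are
  then merged pairwise along a binary tree. If a set \<open>T\<close> inside a block \<open>A\<close> is relevant for only a fraction
  \<open>q\<close> of the assignments \<open>y\<close> of a disjoint block \<open>B\<close>, then the coefficient at \<open>T\<close>, as a function of \<open>y\<close>,
  essentially has support of measure \<open>q\<close>, and hypercontractivity bounds its weight on level \<open>k\<close> by
  \<open>3^k * sqrt q\<close> times its norm. Hence only those \<open>T\<close> with \<open>q\<close> at least exponentially small in \<open>k\<close> survive:
  merging the two parts of \<open>S\<close> costs a factor exponential in \<open>|S|\<close> on each of the \<open>log m\<close> levels of the
  tree, so the weight is concentrated on \<open>m^(O(m))\<close> sets.
\<close>

text \<open>Applied to all coordinates at once, Friedgut's argument makes \<open>T\<close> pay a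
  factor \<open>36^(-|T|)\<close> for each of its elements, so \<open>36^(-|T|^2)\<close> in total.
  For sets of size about \<open>m\<close> this only gives \<open>2^(O(m^2))\<close> sets, too many
  for the claimed exponent. Colouring removes the square: the blocks together pay for the sum of the
  squares of \<open>|T \<inter> J|\<close>, that is, for the pairs of equal colour in
  \<open>T\<close>. With \<open>m\<close> random colours a set of at most \<open>m\<close> elements
  has at most \<open>|T|\<close> expected ordered collisions between distinct elements. One
  colouring that is good on average over the squared coefficients suffices, since Markov's
  inequality discards the sets with too many collisions. The tree controls the other cost: an
  element of \<open>T\<close> is charged a constant factor in each merge above it. Depth
  \<open>log m\<close> keeps the total at \<open>m^(O(m))\<close>, whereas adding the blocks one by
  one could cost \<open>2^(O(m^2))\<close>. Counting sets leaves an additive error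
  \<open>\<theta>^2 * m^(O(m))\<close>; it becomes relative to the variance because a Boolean
  function with this influence has variance at least \<open>2^(-O(m))\<close>.\<close>

section \<open>Fourier analysis on the power set\<close>

text \<open>A point of the cube is encoded as the set of its coordinates equal to 1. Assignments to
  disjoint blocks then combine by union, and restricting a function means fixing one part of that
  union.\<close>

definition avg :: "'a set \<Rightarrow> ('a set \<Rightarrow> real) \<Rightarrow> real" where
  "avg A g = (\<Sum>x\<in>Pow A. g x) / 2 ^ card A"

definition walsh :: "'a set \<Rightarrow> 'a set \<Rightarrow> real" where
  "walsh S x = (- 1) ^ card (S \<inter> x)"

definition coef :: "'a set \<Rightarrow> ('a set \<Rightarrow> real) \<Rightarrow> 'a set \<Rightarrow> real" where
  "coef A g S = avg A (\<lambda>x. g x * walsh S x)"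

lemma avg_cong: "(\<And>x. x \<subseteq> A \<Longrightarrow> g x = h x) \<Longrightarrow> avg A g = avg A h"
  unfolding avg_def by (metis (no_types, lifting) PowD sum.cong)

lemma avg_add: "avg A (\<lambda>x. g x + h x) = avg A g + avg A h"
  unfolding avg_def by (simp add: sum.distrib add_divide_distrib)

lemma avg_diff: "avg A (\<lambda>x. g x - h x) = avg A g - avg A h"
  unfolding avg_def by (simp add: sum_subtractf diff_divide_distrib)

lemma avg_cmult: "avg A (\<lambda>x. c * g x) = c * avg A g"
  unfolding avg_def by (simp add: sum_distrib_left)

lemma avg_sum: "avg A (\<lambda>x. \<Sum>i\<in>I. g i x) = (\<Sum>i\<in>I. avg A (g i))"
  unfolding avg_def using sum.swap[of "\<lambda>x i. g i x" I "Pow A"] by (simp add: sum_divide_distrib)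

lemma avg_const: "finite A \<Longrightarrow> avg A (\<lambda>x. c) = c"
  unfolding avg_def by (simp add: card_Pow)

lemma avg_mono: "(\<And>x. x \<subseteq> A \<Longrightarrow> g x \<le> h x) \<Longrightarrow> avg A g \<le> avg A h"
  unfolding avg_def by (intro divide_right_mono sum_mono) auto

lemma avg_nonneg: "(\<And>x. x \<subseteq> A \<Longrightarrow> 0 \<le> g x) \<Longrightarrow> 0 \<le> avg A g"
  unfolding avg_def by (intro divide_nonneg_pos sum_nonneg) auto

lemma avg_empty [simp]: "avg {} g = g {}"
  by (simp add: avg_def)

lemma bij_betw_Pow_Un:
  assumes "A \<inter> B = {}"
  shows "bij_betw (\<lambda>(x, y). x \<union> y) (Pow A \<times> Pow B) (Pow (A \<union> B))"
proof (rule bij_betwI[where g = "\<lambda>w. (w \<inter> A, w \<inter> B)"])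
qed (use assms in \<open>auto\<close>)

lemma sum_Pow_Un:
  assumes "A \<inter> B = {}"
  shows "(\<Sum>x\<in>Pow (A \<union> B). g x) = (\<Sum>x\<in>Pow A. \<Sum>y\<in>Pow B. g (x \<union> y))"
  using sum.reindex_bij_betw[OF bij_betw_Pow_Un[OF assms], of g]
  by (simp add: sum.cartesian_product split_def)

lemma avg_Un:
  assumes "finite A" "finite B" "A \<inter> B = {}"
  shows "avg (A \<union> B) g = avg A (\<lambda>x. avg B (\<lambda>y. g (x \<union> y)))"
  unfolding avg_def sum_Pow_Un[OF assms(3)]
  by (simp add: card_Un_disjoint assms power_add sum_divide_distrib[symmetric] mult.commute)

lemma avg_swap:
  assumes "finite A" "finite B"
  shows "avg A (\<lambda>x. avg B (\<lambda>y. g x y)) = avg B (\<lambda>y. avg A (\<lambda>x. g x y))"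
  unfolding avg_def using sum.swap[of g "Pow B" "Pow A"]
  by (simp add: sum_divide_distrib[symmetric] mult.commute)

lemma sum_Pow_insert:
  assumes "i \<notin> A"
  shows "(\<Sum>x\<in>Pow (insert i A). g x) = (\<Sum>x\<in>Pow A. g x + g (insert i x))"
proof -
  have "(\<Sum>x\<in>Pow (A \<union> {i}). g x) = (\<Sum>x\<in>Pow A. \<Sum>y\<in>Pow {i}. g (x \<union> y))"
    by (rule sum_Pow_Un) (use assms in auto)
  also have "\<dots> = (\<Sum>x\<in>Pow A. g x + g (insert i x))"
    by (intro sum.cong) (auto simp: Pow_insert add.commute)
  finally show ?thesis by simp
qed

lemma avg_insert:
  assumes "finite A" "i \<notin> A"
  shows "avg (insert i A) g = avg A (\<lambda>x. (g x + g (insert i x)) / 2)"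
  using assms by (simp add: avg_def sum_Pow_insert sum_divide_distrib[symmetric])

lemma walsh_Un:
  assumes "finite A" "finite B" "A \<inter> B = {}" "S \<subseteq> A" "x \<subseteq> A" "U \<subseteq> B" "y \<subseteq> B"
  shows "walsh (S \<union> U) (x \<union> y) = walsh S x * walsh U y"
proof -
  have "(S \<union> U) \<inter> (x \<union> y) = (S \<inter> x) \<union> (U \<inter> y)" using assms by auto
  moreover have "card ((S \<inter> x) \<union> (U \<inter> y)) = card (S \<inter> x) + card (U \<inter> y)"
    by (rule card_Un_disjoint) (use assms in \<open>auto intro: finite_subset\<close>)
  ultimately show ?thesis by (simp add: walsh_def power_add)
qed

lemma walsh_insert:
  assumes "finite A" "i \<notin> A" "S \<subseteq> A" "x \<subseteq> A"
  shows "walsh (insert i S) x = walsh S x" "walsh S (insert i x) = walsh S x" "walsh (insert i S) (insert i x) = - walsh S x"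
proof -
  have 1: "insert i S \<inter> x = S \<inter> x" "S \<inter> insert i x = S \<inter> x"
    "insert i S \<inter> insert i x = insert i (S \<inter> x)" using assms by auto
  have "finite (S \<inter> x)" "i \<notin> S \<inter> x" using assms by (auto intro: finite_subset)
  then show "walsh (insert i S) x = walsh S x" "walsh S (insert i x) = walsh S x" "walsh (insert i S) (insert i x) = - walsh S x"
    by (simp_all add: walsh_def 1)
qed

lemma coef_Un:
  assumes "finite A" "finite B" "A \<inter> B = {}" "S \<subseteq> A" "U \<subseteq> B"
  shows "coef (A \<union> B) g (S \<union> U) = coef B (\<lambda>y. coef A (\<lambda>x. g (x \<union> y)) S) U"
proof -
  have "coef (A \<union> B) g (S \<union> U) = avg A (\<lambda>x. avg B (\<lambda>y. g (x \<union> y) * (walsh S x * walsh U y)))"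
    unfolding coef_def avg_Un[OF assms(1-3)]
    by (intro avg_cong) (simp add: walsh_Un[OF assms(1-4) _ assms(5)])
  also have "\<dots> = avg B (\<lambda>y. avg A (\<lambda>x. g (x \<union> y) * (walsh S x * walsh U y)))"
    by (rule avg_swap) (use assms in auto)
  also have "\<dots> = avg B (\<lambda>y. avg A (\<lambda>x. g (x \<union> y) * walsh S x) * walsh U y)"
    by (intro avg_cong) (simp add: avg_cmult[symmetric] mult_ac)
  finally show ?thesis by (simp add: coef_def)
qed

text \<open>Averaging over coordinate \<open>i\<close> alone leaves the part of \<open>g\<close>
  that is even in \<open>i\<close> or, against the character, the odd part, which is the discrete
  derivative. Both Parseval and the influence formulas rest on this step.\<close>

lemma coef_insert:
  assumes "finite A" "i \<notin> A" "T \<subseteq> A"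
  shows "coef (insert i A) g T = coef A (\<lambda>x. (g x + g (insert i x)) / 2) T"
    "coef (insert i A) g (insert i T) = coef A (\<lambda>x. (g x - g (insert i x)) / 2) T"
  unfolding coef_def avg_insert[OF assms(1,2)] using assms
  by (auto intro!: avg_cong simp: walsh_insert field_simps)

lemma parseval:
  assumes "finite A"
  shows "(\<Sum>T\<in>Pow A. (coef A g T)\<^sup>2) = avg A (\<lambda>x. (g x)\<^sup>2)"
  using assms
proof (induction A arbitrary: g)
  case empty
  then show ?case by (simp add: coef_def walsh_def)
next
  case (insert i A)
  have "(\<Sum>T\<in>Pow (insert i A). (coef (insert i A) g T)\<^sup>2) =
    (\<Sum>T\<in>Pow A. (coef A (\<lambda>x. (g x + g (insert i x)) / 2) T)\<^sup>2) +
    (\<Sum>T\<in>Pow A. (coef A (\<lambda>x. (g x - g (insert i x)) / 2) T)\<^sup>2)"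
    unfolding sum_Pow_insert[OF insert(2)] sum.distrib[symmetric]
    by (intro sum.cong) (simp_all add: coef_insert insert)
  also have "\<dots> = avg (insert i A) (\<lambda>x. (g x)\<^sup>2)"
    unfolding insert.IH avg_insert[OF insert(1,2)] avg_add[symmetric]
    by (intro avg_cong) (simp add: power2_eq_square field_simps)
  finally show ?case .
qed

lemma fourier_sum_insert:
  assumes "finite A" "i \<notin> A" "x \<subseteq> A"
  shows "(\<Sum>T\<in>Pow (insert i A). c T * walsh T x) =
      (\<Sum>T\<in>Pow A. c T * walsh T x) + (\<Sum>T\<in>Pow A. c (insert i T) * walsh T x)"
    "(\<Sum>T\<in>Pow (insert i A). c T * walsh T (insert i x)) =
      (\<Sum>T\<in>Pow A. c T * walsh T x) - (\<Sum>T\<in>Pow A. c (insert i T) * walsh T x)"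
  unfolding sum_Pow_insert[OF assms(2)] sum.distrib[symmetric] sum_subtractf[symmetric]
  by (auto intro!: sum.cong simp: walsh_insert[OF assms(1,2) _ assms(3)])

section \<open>Hypercontractivity and functions of small support\<close>

lemma avg_cauchy_schwarz: "(avg A (\<lambda>x. g x * h x))\<^sup>2 \<le> avg A (\<lambda>x. (g x)\<^sup>2) * avg A (\<lambda>x. (h x)\<^sup>2)"
  unfolding avg_def power_divide times_divide_times_eq power2_eq_square[of "2 ^ card A"]
  by (intro divide_right_mono Cauchy_Schwarz_ineq_sum) auto

text \<open>Induction on the coordinates. The polynomial is \<open>a + b\<close> or
  \<open>a - b\<close> according to the value of coordinate \<open>i\<close>, so averaging leaves
  \<open>a^4 + 6 a^2 b^2 + b^4\<close>. Since \<open>b\<close> has degree at most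
  \<open>k - 1\<close>, its fourth moment gains a factor 1/9; Cauchy-Schwarz turns this into 1/3 in
  the cross term, and 6/3 = 2 completes the square \<open>(p + q)^2\<close>.\<close>

lemma bonami:
  assumes "finite A" "\<And>T. T \<subseteq> A \<Longrightarrow> k < card T \<Longrightarrow> c T = 0"
  shows "avg A (\<lambda>x. (\<Sum>T\<in>Pow A. c T * walsh T x) ^ 4) \<le> 9 ^ k * (\<Sum>T\<in>Pow A. (c T)\<^sup>2)\<^sup>2"
  using assms
proof (induction A arbitrary: c k)
  case empty
  have "c {} ^ 4 \<le> 9 ^ k * c {} ^ 4" by (simp add: mult_le_cancel_right1)
  then show ?case by (simp add: walsh_def)
next
  case (insert i A)
  define a where "a x = (\<Sum>T\<in>Pow A. c T * walsh T x)" for x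
  define b where "b x = (\<Sum>T\<in>Pow A. c (insert i T) * walsh T x)" for x
  define p where "p = (\<Sum>T\<in>Pow A. (c T)\<^sup>2)"
  define q where "q = (\<Sum>T\<in>Pow A. (c (insert i T))\<^sup>2)"
  have pq: "0 \<le> p" "0 \<le> q" by (auto simp: p_def q_def intro: sum_nonneg)
  have a4: "avg A (\<lambda>x. a x ^ 4) \<le> 9 ^ k * p\<^sup>2"
    unfolding a_def p_def by (rule insert.IH) (use insert.prems in blast)
  have b4: "9 * avg A (\<lambda>x. b x ^ 4) \<le> 9 ^ k * q\<^sup>2"
  proof (cases k)
    \<comment> \<open>There is no degree \<open>k - 1\<close> to induct on, but
      \<open>insert i T\<close> is nonempty, so all coefficients of \<open>b\<close> vanish.\<close>
    case 0
    have "c (insert i T) = 0" if "T \<subseteq> A" for T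
    proof (rule insert.prems)
      show "insert i T \<subseteq> insert i A" using that by auto
      have "finite T" using that insert by (auto intro: finite_subset)
      then show "k < card (insert i T)" using 0 by (simp add: card_gt_0_iff)
    qed
    then have "avg A (\<lambda>x. b x ^ 4) = 0" "q = 0"
      by (auto simp: b_def q_def avg_def intro!: sum.neutral)
    then show ?thesis by simp
  next
    case (Suc l)
    have "avg A (\<lambda>x. b x ^ 4) \<le> 9 ^ l * q\<^sup>2"
      unfolding b_def q_def
    proof (rule insert.IH)
      fix T assume T: "T \<subseteq> A" "l < card T"
      have "finite T" "i \<notin> T" using T insert by (auto intro: finite_subset)
      then have "k < card (insert i T)" using T Suc by simp
      then show "c (insert i T) = 0" using insert.prems[of "insert i T"] T by auto
    qed
    then show ?thesis using Suc by simp
  qed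
  have ab: "avg A (\<lambda>x. (a x)\<^sup>2 * (b x)\<^sup>2) \<le> 9 ^ k * p * q / 3"
  proof (rule power2_le_imp_le)
    have "(avg A (\<lambda>x. (a x)\<^sup>2 * (b x)\<^sup>2))\<^sup>2 \<le> avg A (\<lambda>x. ((a x)\<^sup>2)\<^sup>2) * avg A (\<lambda>x. ((b x)\<^sup>2)\<^sup>2)"
      by (rule avg_cauchy_schwarz)
    also have "\<dots> = avg A (\<lambda>x. a x ^ 4) * avg A (\<lambda>x. b x ^ 4)" by (simp flip: power_mult)
    also have "\<dots> \<le> (9 ^ k * p\<^sup>2) * (9 ^ k * q\<^sup>2 / 9)"
      using a4 b4 by (intro mult_mono avg_nonneg) auto
    also have "\<dots> = (9 ^ k * p * q / 3)\<^sup>2" by (simp add: power2_eq_square)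
    finally show "(avg A (\<lambda>x. (a x)\<^sup>2 * (b x)\<^sup>2))\<^sup>2 \<le> (9 ^ k * p * q / 3)\<^sup>2" .
    show "0 \<le> 9 ^ k * p * q / 3" using pq by simp
  qed
  have "avg (insert i A) (\<lambda>x. (\<Sum>T\<in>Pow (insert i A). c T * walsh T x) ^ 4) =
     avg A (\<lambda>x. (a x ^ 4 + 6 * ((a x)\<^sup>2 * (b x)\<^sup>2)) + b x ^ 4)"
    unfolding avg_insert[OF insert(1,2)]
  proof (rule avg_cong)
    fix x assume "x \<subseteq> A"
    then have ab_sum: "(\<Sum>T\<in>Pow (insert i A). c T * walsh T x) = a x + b x"
      "(\<Sum>T\<in>Pow (insert i A). c T * walsh T (insert i x)) = a x - b x"
      by (simp_all only: fourier_sum_insert insert.hyps a_def b_def not_False_eq_True)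
    show "((\<Sum>T\<in>Pow (insert i A). c T * walsh T x) ^ 4 +
        (\<Sum>T\<in>Pow (insert i A). c T * walsh T (insert i x)) ^ 4) / 2 =
        (a x ^ 4 + 6 * ((a x)\<^sup>2 * (b x)\<^sup>2)) + b x ^ 4"
      unfolding ab_sum by (simp add: power4_eq_xxxx power2_eq_square field_simps)
  qed
  also have "\<dots> = avg A (\<lambda>x. a x ^ 4) + 6 * avg A (\<lambda>x. (a x)\<^sup>2 * (b x)\<^sup>2) + avg A (\<lambda>x. b x ^ 4)"
    by (simp add: avg_add avg_cmult)
  also have "\<dots> \<le> 9 ^ k * p\<^sup>2 + 6 * (9 ^ k * p * q / 3) + 9 ^ k * q\<^sup>2"
  proof -
    have "0 \<le> avg A (\<lambda>x. b x ^ 4)" by (intro avg_nonneg) auto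
    then show ?thesis using a4 b4 ab by linarith
  qed
  also have "\<dots> = 9 ^ k * (p + q)\<^sup>2" by (simp add: power2_eq_square algebra_simps)
  also have "p + q = (\<Sum>T\<in>Pow (insert i A). (c T)\<^sup>2)"
    by (simp add: p_def q_def sum_Pow_insert insert sum.distrib)
  finally show ?case .
qed

text \<open>Duality. The level-\<open>k\<close> part \<open>G\<close> of \<open>F\<close> has
  squared norm \<open>w = E[F G] = E[F I G]\<close>, where \<open>I\<close> is the indicator of the
  support. Cauchy-Schwarz reduces \<open>w^2\<close> to \<open>E[F^2] E[I G^2]\<close>; a second use
  together with \<open>bonami\<close> gives \<open>E[I G^2] <= sqrt q * 3^k * w\<close>, and one
  factor \<open>w\<close> cancels.\<close>

lemma level_small_support:
  assumes fin: "finite B" and q: "avg B (\<lambda>y. of_bool (F y \<noteq> 0)) \<le> q"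
  shows "(\<Sum>U | U \<subseteq> B \<and> card U = k. (coef B F U)\<^sup>2) \<le> 3 ^ k * sqrt q * avg B (\<lambda>y. (F y)\<^sup>2)"
proof -
  define c where "c U = coef B F U * of_bool (card U = k)" for U
  define G where "G y = (\<Sum>U\<in>Pow B. c U * walsh U y)" for y
  define w where "w = (\<Sum>U\<in>Pow B. (c U)\<^sup>2)"
  define I where "I y = (of_bool (F y \<noteq> 0) :: real)" for y
  have w0: "0 \<le> w" by (auto simp: w_def intro: sum_nonneg)
  have q0: "0 \<le> q" using q avg_nonneg[of B "\<lambda>y. of_bool (F y \<noteq> 0)"] by force
  have weq: "w = (\<Sum>U | U \<subseteq> B \<and> card U = k. (coef B F U)\<^sup>2)"
  proof -
    have "w = (\<Sum>U\<in>Pow B. if card U = k then (coef B F U)\<^sup>2 else 0)"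
      unfolding w_def c_def by (intro sum.cong) auto
    also have "\<dots> = (\<Sum>U\<in>{U\<in>Pow B. card U = k}. (coef B F U)\<^sup>2)"
      by (rule sum.inter_filter[symmetric]) (use fin in simp)
    finally show ?thesis by (simp add: Pow_def)
  qed
  have "w = (\<Sum>U\<in>Pow B. c U * coef B F U)"
    unfolding w_def c_def by (intro sum.cong) (auto simp: power2_eq_square)
  also have "\<dots> = avg B (\<lambda>y. F y * G y)"
    unfolding G_def coef_def sum_distrib_left avg_sum avg_cmult[symmetric]
    by (intro sum.cong avg_cong) auto
  also have "\<dots> = avg B (\<lambda>y. F y * (I y * G y))"
    by (intro avg_cong) (auto simp: I_def)
  finally have wF: "w = avg B (\<lambda>y. F y * (I y * G y))" .
  have "(avg B (\<lambda>y. (I y * G y)\<^sup>2))\<^sup>2 = (avg B (\<lambda>y. I y * (G y)\<^sup>2))\<^sup>2"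
    by (intro arg_cong[where f = "\<lambda>t. t\<^sup>2"] avg_cong) (auto simp: I_def)
  also have "\<dots> \<le> avg B (\<lambda>y. (I y)\<^sup>2) * avg B (\<lambda>y. ((G y)\<^sup>2)\<^sup>2)" by (rule avg_cauchy_schwarz)
  also have "\<dots> = avg B I * avg B (\<lambda>y. (G y) ^ 4)"
    by (intro arg_cong2[where f = "(*)"] avg_cong) (auto simp: I_def simp flip: power_mult)
  also have "\<dots> \<le> q * (9 ^ k * w\<^sup>2)"
  proof (rule mult_mono)
    show "avg B I \<le> q" using q by (simp add: I_def[abs_def])
    show "avg B (\<lambda>y. (G y) ^ 4) \<le> 9 ^ k * w\<^sup>2"
      unfolding G_def w_def by (rule bonami) (auto simp: fin c_def)
  qed (use q0 in \<open>auto intro: avg_nonneg\<close>)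
  also have "\<dots> = (sqrt q * 3 ^ k * w)\<^sup>2"
  proof -
    have "(3 ^ k :: real)\<^sup>2 = 9 ^ k" by (simp add: power2_eq_square flip: power_mult_distrib)
    then show ?thesis using q0 by (simp add: power_mult_distrib)
  qed
  finally have IG: "avg B (\<lambda>y. (I y * G y)\<^sup>2) \<le> sqrt q * 3 ^ k * w"
    by (rule power2_le_imp_le) (use q0 w0 in auto)
  have "w\<^sup>2 \<le> avg B (\<lambda>y. (F y)\<^sup>2) * avg B (\<lambda>y. (I y * G y)\<^sup>2)"
    unfolding wF by (rule avg_cauchy_schwarz)
  also have "\<dots> \<le> avg B (\<lambda>y. (F y)\<^sup>2) * (sqrt q * 3 ^ k * w)"
    by (intro mult_left_mono IG avg_nonneg) auto
  finally have *: "w * w \<le> w * (3 ^ k * sqrt q * avg B (\<lambda>y. (F y)\<^sup>2))"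
    by (simp add: power2_eq_square mult_ac)
  have "w \<le> 3 ^ k * sqrt q * avg B (\<lambda>y. (F y)\<^sup>2)"
  proof (cases "w = 0")
    case True
    then show ?thesis using q0 by (auto intro!: mult_nonneg_nonneg avg_nonneg)
  next
    case False
    then show ?thesis using * w0 by (simp add: mult_le_cancel_left)
  qed
  then show ?thesis by (simp add: weq)
qed

text \<open>The base 36 is chosen so that its square root 6 beats the factor 3 of the level
  inequality and leaves \<open>2^(-k)\<close> on level \<open>k\<close>. These sum to at most 2,
  which the 1/4 under the root compensates.\<close>

lemma small_support_weight:
  assumes fin: "finite B" and eps: "0 < \<epsilon>" and P: "P \<subseteq> Pow B"
    and q: "\<And>U. U \<in> P \<Longrightarrow> avg B (\<lambda>y. of_bool (F y \<noteq> 0)) \<le> \<epsilon>\<^sup>2 / 4 * (1 / 36) ^ card U"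
  shows "(\<Sum>U\<in>P. (coef B F U)\<^sup>2) \<le> \<epsilon> * avg B (\<lambda>y. (F y)\<^sup>2)"
proof -
  have finP: "finite P" using P fin by (auto intro: finite_subset)
  define N where "N = avg B (\<lambda>y. (F y)\<^sup>2)"
  have N: "0 \<le> N" unfolding N_def by (intro avg_nonneg) auto
  have "(\<Sum>U\<in>P. (coef B F U)\<^sup>2) = (\<Sum>k\<in>card ` P. \<Sum>U | U \<in> P \<and> card U = k. (coef B F U)\<^sup>2)"
    using finP by (rule sum.image_gen)
  also have "\<dots> \<le> (\<Sum>k\<in>card ` P. (1 / 2) ^ k * (\<epsilon> / 2 * N))"
  proof (rule sum_mono)
    fix k assume "k \<in> card ` P"
    \<comment> \<open>The support bound depends on \<open>U\<close> only through its size, so one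
      member of \<open>P\<close> on a level serves the whole level.\<close>
    then obtain V where V: "V \<in> P" "card V = k" by auto
    have "(\<Sum>U | U \<in> P \<and> card U = k. (coef B F U)\<^sup>2) \<le> (\<Sum>U | U \<subseteq> B \<and> card U = k. (coef B F U)\<^sup>2)"
      using fin P by (intro sum_mono2) auto
    also have "\<dots> \<le> 3 ^ k * sqrt (\<epsilon>\<^sup>2 / 4 * (1 / 36) ^ k) * N"
      unfolding N_def by (rule level_small_support[OF fin]) (use q[OF V(1)] V(2) in simp)
    also have "sqrt (\<epsilon>\<^sup>2 / 4 * (1 / 36) ^ k) = \<epsilon> / 2 * (1 / 6) ^ k"
    proof (rule real_sqrt_unique)
      have "((1 / 6) ^ k :: real)\<^sup>2 = (1 / 36) ^ k"
        by (simp add: power2_eq_square flip: power_mult_distrib)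
      then show "(\<epsilon> / 2 * (1 / 6) ^ k)\<^sup>2 = \<epsilon>\<^sup>2 / 4 * (1 / 36) ^ k"
        by (simp only: power_mult_distrib) (simp add: power2_eq_square)
    qed (use eps in simp)
    also have "3 ^ k * (\<epsilon> / 2 * (1 / 6) ^ k) = (1 / 2) ^ k * (\<epsilon> / 2)"
    proof -
      have "3 ^ k * (1 / 6) ^ k = ((1 / 2) ^ k :: real)" by (simp flip: power_mult_distrib)
      then show ?thesis by simp
    qed
    finally show "(\<Sum>U | U \<in> P \<and> card U = k. (coef B F U)\<^sup>2) \<le> (1 / 2) ^ k * (\<epsilon> / 2 * N)"
      by (simp add: mult_ac)
  qed
  also have "\<dots> = (\<Sum>k\<in>card ` P. (1 / 2) ^ k) * (\<epsilon> / 2 * N)" by (simp add: sum_distrib_right)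
  also have "\<dots> \<le> 2 * (\<epsilon> / 2 * N)"
  proof (rule mult_right_mono)
    have "(\<Sum>k\<in>card ` P. (1 / 2 :: real) ^ k) \<le> (\<Sum>k. (1 / 2) ^ k)"
      using finP by (intro sum_le_suminf summable_geometric) auto
    also have "\<dots> = 2" by (subst suminf_geometric) auto
    finally show "(\<Sum>k\<in>card ` P. (1 / 2 :: real) ^ k) \<le> 2" .
  qed (use eps N in simp)
  finally show ?thesis by (simp add: N_def)
qed

section \<open>Merging blocks\<close>

definition restr_coef :: "'a set \<Rightarrow> ('a set \<Rightarrow> real) \<Rightarrow> 'a set \<Rightarrow> 'a set \<Rightarrow> real" where
  "restr_coef X g z T = coef X (\<lambda>x. g (x \<union> z)) T"

text \<open>For every assignment \<open>z\<close> outside \<open>X\<close>, the sub-probability \<open>\<nu> z\<close> on the subsets of \<open>X\<close> plays the role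
  of a family of relevant sets, namely those with \<open>\<nu> z T \<ge> \<beta> T\<close>; there are at most \<open>1 / b\<close> of them with
  \<open>\<beta> T \<ge> b\<close>. Unlike families, such measures can be averaged over \<open>z\<close> and multiplied.\<close>

definition concentrated ::
  "'a set \<Rightarrow> ('a set \<Rightarrow> real) \<Rightarrow> 'a set \<Rightarrow> ('a set \<Rightarrow> real) \<Rightarrow> real \<Rightarrow> bool" where
  "concentrated V g X \<beta> e \<longleftrightarrow> (\<exists>\<nu>. (\<forall>z T. 0 \<le> \<nu> z T) \<and> (\<forall>z. (\<Sum>T\<in>Pow X. \<nu> z T) \<le> 1) \<and>
     avg (V - X) (\<lambda>z. \<Sum>T\<in>Pow X. of_bool (\<nu> z T < \<beta> T) * (restr_coef X g z T)\<^sup>2) \<le> e)"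

lemma coef_add: "coef B (\<lambda>y. F y + G y) U = coef B F U + coef B G U"
  by (simp add: coef_def avg_add[symmetric] distrib_right)

text \<open>By Markov's inequality, the part of \<open>r\<close> on \<open>{p \<ge> \<beta>}\<close> has support of measure at most \<open>avg B p / \<beta>\<close>.\<close>

lemma split_weight:
  assumes fin: "finite B" and eps: "0 < \<epsilon>" and p: "\<And>y. 0 \<le> p y" and \<beta>: "0 < \<beta>"
  shows "(\<Sum>U\<in>Pow B. of_bool (avg B p < \<epsilon>\<^sup>2 / 4 * (1 / 36) ^ card U * \<beta>) * (coef B r U)\<^sup>2) \<le>
    2 * \<epsilon> * avg B (\<lambda>y. (r y)\<^sup>2) + 2 * avg B (\<lambda>y. of_bool (p y < \<beta>) * (r y)\<^sup>2)"
proof -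
  define F where "F y = of_bool (\<beta> \<le> p y) * r y" for y
  define G where "G y = of_bool (p y < \<beta>) * r y" for y
  define P where "P = {U\<in>Pow B. avg B p < \<epsilon>\<^sup>2 / 4 * (1 / 36) ^ card U * \<beta>}"
  have finP: "finite P" using fin by (simp add: P_def)
  have r: "r = (\<lambda>y. F y + G y)" by (auto simp: F_def G_def)
  have "(\<Sum>U\<in>Pow B. of_bool (avg B p < \<epsilon>\<^sup>2 / 4 * (1 / 36) ^ card U * \<beta>) * (coef B r U)\<^sup>2) =
    (\<Sum>U\<in>P. (coef B r U)\<^sup>2)"
  proof -
    have "(\<Sum>U\<in>P. (coef B r U)\<^sup>2) =
      (\<Sum>U\<in>Pow B. if avg B p < \<epsilon>\<^sup>2 / 4 * (1 / 36) ^ card U * \<beta> then (coef B r U)\<^sup>2 else 0)"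
      unfolding P_def by (rule sum.inter_filter) (use fin in simp)
    also have "\<dots> = (\<Sum>U\<in>Pow B. of_bool (avg B p < \<epsilon>\<^sup>2 / 4 * (1 / 36) ^ card U * \<beta>) * (coef B r U)\<^sup>2)"
      by (intro sum.cong) auto
    finally show ?thesis ..
  qed
  also have "\<dots> \<le> (\<Sum>U\<in>P. 2 * (coef B F U)\<^sup>2 + 2 * (coef B G U)\<^sup>2)"
  proof (rule sum_mono)
    fix U
    have "0 \<le> (coef B F U - coef B G U)\<^sup>2" by simp
    then show "(coef B r U)\<^sup>2 \<le> 2 * (coef B F U)\<^sup>2 + 2 * (coef B G U)\<^sup>2"
      unfolding r coef_add by (simp add: power2_eq_square algebra_simps)
  qed
  also have "\<dots> = 2 * (\<Sum>U\<in>P. (coef B F U)\<^sup>2) + 2 * (\<Sum>U\<in>P. (coef B G U)\<^sup>2)"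
    by (simp add: sum.distrib sum_distrib_left)
  also have "(\<Sum>U\<in>P. (coef B F U)\<^sup>2) \<le> \<epsilon> * avg B (\<lambda>y. (F y)\<^sup>2)"
  proof (rule small_support_weight[OF fin eps])
    fix U assume U: "U \<in> P"
    have "\<beta> * avg B (\<lambda>y. of_bool (F y \<noteq> 0)) = avg B (\<lambda>y. \<beta> * of_bool (F y \<noteq> 0))"
      by (simp add: avg_cmult)
    also have "\<dots> \<le> avg B p"
      by (intro avg_mono) (auto simp: F_def p)
    also have "\<dots> \<le> \<beta> * (\<epsilon>\<^sup>2 / 4 * (1 / 36) ^ card U)"
      using U by (simp add: P_def mult.commute)
    finally show "avg B (\<lambda>y. of_bool (F y \<noteq> 0)) \<le> \<epsilon>\<^sup>2 / 4 * (1 / 36) ^ card U"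
      using \<beta> by (simp add: mult_le_cancel_left)
  qed (auto simp: P_def)
  also have "avg B (\<lambda>y. (F y)\<^sup>2) \<le> avg B (\<lambda>y. (r y)\<^sup>2)"
    by (intro avg_mono) (auto simp: F_def)
  also have "(\<Sum>U\<in>P. (coef B G U)\<^sup>2) \<le> (\<Sum>U\<in>Pow B. (coef B G U)\<^sup>2)"
    by (intro sum_mono2) (auto simp: fin P_def)
  also have "\<dots> = avg B (\<lambda>y. (G y)\<^sup>2)" by (rule parseval[OF fin])
  also have "\<dots> = avg B (\<lambda>y. of_bool (p y < \<beta>) * (r y)\<^sup>2)"
    by (intro avg_cong) (auto simp: G_def)
  finally show ?thesis using eps by simp
qed

text \<open>Taking the coefficient in \<open>A\<close> first leaves a function of the assignment
  \<open>y\<close> to \<open>B\<close>. It is to these coefficient functions that the small-support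
  estimates are applied.\<close>

lemma restr_coef_Un:
  assumes "finite A" "finite B" "A \<inter> B = {}" "T \<subseteq> A" "U \<subseteq> B"
  shows "restr_coef (A \<union> B) g z (T \<union> U) = coef B (\<lambda>y. restr_coef A g (z \<union> y) T) U"
  unfolding restr_coef_def coef_Un[OF assms] by (simp add: Un_ac)

lemma avg_restr_parseval:
  assumes "finite V" "A \<subseteq> V"
  shows "avg (V - A) (\<lambda>z. \<Sum>T\<in>Pow A. (restr_coef A g z T)\<^sup>2) = avg V (\<lambda>x. (g x)\<^sup>2)"
proof -
  have fin: "finite A" "finite (V - A)" using assms by (auto intro: finite_subset)
  have "avg ((V - A) \<union> A) (\<lambda>x. (g x)\<^sup>2) = avg (V - A) (\<lambda>z. avg A (\<lambda>x. (g (z \<union> x))\<^sup>2))"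
    by (rule avg_Un) (use fin in auto)
  also have "(V - A) \<union> A = V" using assms by auto
  finally show ?thesis unfolding restr_coef_def parseval[OF fin(1)] by (simp add: Un_commute)
qed

text \<open>Half of a merge: it accounts for the pairs whose part \<open>T\<close> in
  \<open>A\<close> has too little averaged measure. For fixed \<open>z\<close> and \<open>T\<close>,
  \<open>split_weight\<close> applies to the coefficient at \<open>T\<close> as a function of
  \<open>y\<close>, with \<open>p\<close> the measure of \<open>T\<close>. Averaging over
  \<open>z\<close> and Parseval collect the norms into that of \<open>g\<close>.\<close>

lemma one_sided_weight:
  assumes fin: "finite V" and sub: "A \<subseteq> V" "B \<subseteq> V" and disj: "A \<inter> B = {}" and eps: "0 < \<epsilon>"
    and \<beta>: "\<And>T. 0 < \<beta> T" and \<nu>: "\<And>z T. 0 \<le> \<nu> z T"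
    and e: "avg (V - A) (\<lambda>z. \<Sum>T\<in>Pow A. of_bool (\<nu> z T < \<beta> T) * (restr_coef A g z T)\<^sup>2) \<le> e"
  shows "avg (V - (A \<union> B)) (\<lambda>z. \<Sum>T\<in>Pow A. \<Sum>U\<in>Pow B.
      of_bool (avg B (\<lambda>y. \<nu> (z \<union> y) T) < \<epsilon>\<^sup>2 / 4 * (1 / 36) ^ card U * \<beta> T) *
      (restr_coef (A \<union> B) g z (T \<union> U))\<^sup>2) \<le> 2 * \<epsilon> * avg V (\<lambda>x. (g x)\<^sup>2) + 2 * e"
    (is "?L \<le> _")
proof -
  define W where "W = V - (A \<union> B)"
  have finA: "finite A" "finite B" "finite W" using assms by (auto intro: finite_subset simp: W_def)
  have WB: "avg (V - A) h = avg W (\<lambda>z. avg B (\<lambda>y. h (z \<union> y)))" for h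
  proof -
    have "V - A = W \<union> B" using sub disj by (auto simp: W_def)
    moreover have "avg (W \<union> B) h = avg W (\<lambda>z. avg B (\<lambda>y. h (z \<union> y)))"
      by (rule avg_Un) (use finA in \<open>auto simp: W_def\<close>)
    ultimately show ?thesis by simp
  qed
  have "?L \<le> avg W (\<lambda>z. \<Sum>T\<in>Pow A. 2 * \<epsilon> * avg B (\<lambda>y. (restr_coef A g (z \<union> y) T)\<^sup>2) +
      2 * avg B (\<lambda>y. of_bool (\<nu> (z \<union> y) T < \<beta> T) * (restr_coef A g (z \<union> y) T)\<^sup>2))"
    unfolding W_def[symmetric]
  proof (intro avg_mono sum_mono)
    fix z T assume "z \<subseteq> W" and T: "T \<in> Pow A"
    have "(\<Sum>U\<in>Pow B. of_bool (avg B (\<lambda>y. \<nu> (z \<union> y) T) < \<epsilon>\<^sup>2 / 4 * (1 / 36) ^ card U * \<beta> T) *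
        (restr_coef (A \<union> B) g z (T \<union> U))\<^sup>2) =
      (\<Sum>U\<in>Pow B. of_bool (avg B (\<lambda>y. \<nu> (z \<union> y) T) < \<epsilon>\<^sup>2 / 4 * (1 / 36) ^ card U * \<beta> T) *
        (coef B (\<lambda>y. restr_coef A g (z \<union> y) T) U)\<^sup>2)"
      using T by (intro sum.cong refl) (simp add: restr_coef_Un[OF finA(1,2) disj])
    also have "\<dots> \<le> 2 * \<epsilon> * avg B (\<lambda>y. (restr_coef A g (z \<union> y) T)\<^sup>2) +
      2 * avg B (\<lambda>y. of_bool (\<nu> (z \<union> y) T < \<beta> T) * (restr_coef A g (z \<union> y) T)\<^sup>2)"
      by (rule split_weight[OF finA(2) eps \<nu> \<beta>])
    finally show "(\<Sum>U\<in>Pow B. of_bool (avg B (\<lambda>y. \<nu> (z \<union> y) T) < \<epsilon>\<^sup>2 / 4 * (1 / 36) ^ card U * \<beta> T) *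
        (restr_coef (A \<union> B) g z (T \<union> U))\<^sup>2) \<le> 2 * \<epsilon> * avg B (\<lambda>y. (restr_coef A g (z \<union> y) T)\<^sup>2) +
      2 * avg B (\<lambda>y. of_bool (\<nu> (z \<union> y) T < \<beta> T) * (restr_coef A g (z \<union> y) T)\<^sup>2)" .
  qed
  also have "\<dots> = 2 * \<epsilon> * avg (V - A) (\<lambda>z. \<Sum>T\<in>Pow A. (restr_coef A g z T)\<^sup>2) +
      2 * avg (V - A) (\<lambda>z. \<Sum>T\<in>Pow A. of_bool (\<nu> z T < \<beta> T) * (restr_coef A g z T)\<^sup>2)"
    unfolding WB by (simp add: sum.distrib avg_add avg_sum avg_cmult sum_distrib_left)
  also have "\<dots> \<le> 2 * \<epsilon> * avg V (\<lambda>x. (g x)\<^sup>2) + 2 * e"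
    using e by (simp add: avg_restr_parseval[OF fin sub(1)])
  finally show ?thesis .
qed

text \<open>Average each measure over the other block, then multiply. A product below the product of
  two thresholds has a factor below its own threshold, so every lost set is charged to one side and
  \<open>one_sided_weight\<close> applies twice. The thresholds are crossed: the part in
  \<open>A\<close> is tested at a level depending on the size of the part in \<open>B\<close> and
  conversely, which together gives \<open>36^(-|T|)\<close>.\<close>

lemma concentrated_Un:
  assumes fin: "finite V" and sub: "A \<subseteq> V" "B \<subseteq> V" and disj: "A \<inter> B = {}" and eps: "0 < \<epsilon>"
    and \<beta>: "\<And>T. 0 < \<beta>\<^sub>1 T" "\<And>T. 0 < \<beta>\<^sub>2 T"
    and conc: "concentrated V g A \<beta>\<^sub>1 e\<^sub>1" "concentrated V g B \<beta>\<^sub>2 e\<^sub>2"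
  shows "concentrated V g (A \<union> B)
    (\<lambda>T. \<epsilon> ^ 4 / 16 * (1 / 36) ^ card T * \<beta>\<^sub>1 (T \<inter> A) * \<beta>\<^sub>2 (T \<inter> B))
    (2 * e\<^sub>1 + 2 * e\<^sub>2 + 4 * \<epsilon> * avg V (\<lambda>x. (g x)\<^sup>2))"
proof -
  have finA: "finite A" "finite B" using assms by (auto intro: finite_subset)
  obtain \<nu>\<^sub>1 where \<nu>1: "\<And>z T. 0 \<le> \<nu>\<^sub>1 z T" "\<And>z. (\<Sum>T\<in>Pow A. \<nu>\<^sub>1 z T) \<le> 1"
    "avg (V - A) (\<lambda>z. \<Sum>T\<in>Pow A. of_bool (\<nu>\<^sub>1 z T < \<beta>\<^sub>1 T) * (restr_coef A g z T)\<^sup>2) \<le> e\<^sub>1"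
    using conc(1) unfolding concentrated_def by blast
  obtain \<nu>\<^sub>2 where \<nu>2: "\<And>z T. 0 \<le> \<nu>\<^sub>2 z T" "\<And>z. (\<Sum>T\<in>Pow B. \<nu>\<^sub>2 z T) \<le> 1"
    "avg (V - B) (\<lambda>z. \<Sum>T\<in>Pow B. of_bool (\<nu>\<^sub>2 z T < \<beta>\<^sub>2 T) * (restr_coef B g z T)\<^sup>2) \<le> e\<^sub>2"
    using conc(2) unfolding concentrated_def by blast
  define a where "a z T = avg B (\<lambda>y. \<nu>\<^sub>1 (z \<union> y) T)" for z T
  define b where "b z U = avg A (\<lambda>x. \<nu>\<^sub>2 (z \<union> x) U)" for z U
  have a0: "0 \<le> a z T" "0 \<le> b z T" for z T
    unfolding a_def b_def by (auto intro!: avg_nonneg \<nu>1 \<nu>2)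
  have a1: "(\<Sum>T\<in>Pow A. a z T) \<le> 1" for z
  proof -
    have "(\<Sum>T\<in>Pow A. a z T) = avg B (\<lambda>y. \<Sum>T\<in>Pow A. \<nu>\<^sub>1 (z \<union> y) T)"
      unfolding a_def by (simp add: avg_sum)
    also have "\<dots> \<le> avg B (\<lambda>y. 1)" by (intro avg_mono \<nu>1)
    finally show ?thesis by (simp add: avg_const finA)
  qed
  have b1: "(\<Sum>T\<in>Pow B. b z T) \<le> 1" for z
  proof -
    have "(\<Sum>T\<in>Pow B. b z T) = avg A (\<lambda>y. \<Sum>T\<in>Pow B. \<nu>\<^sub>2 (z \<union> y) T)"
      unfolding b_def by (simp add: avg_sum)
    also have "\<dots> \<le> avg A (\<lambda>y. 1)" by (intro avg_mono \<nu>2)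
    finally show ?thesis by (simp add: avg_const finA)
  qed
  let ?X = "A \<union> B"
  let ?\<nu> = "\<lambda>z T. a z (T \<inter> A) * b z (T \<inter> B)"
  let ?\<beta> = "\<lambda>T. \<epsilon> ^ 4 / 16 * (1 / 36) ^ card T * \<beta>\<^sub>1 (T \<inter> A) * \<beta>\<^sub>2 (T \<inter> B)"
  let ?q = "\<lambda>U. \<epsilon>\<^sup>2 / 4 * (1 / 36) ^ card U"
  have int: "(T \<union> U) \<inter> A = T" "(T \<union> U) \<inter> B = U" if "T \<in> Pow A" "U \<in> Pow B" for T U
    using that disj by auto
  have sum1: "(\<Sum>T\<in>Pow ?X. ?\<nu> z T) \<le> 1" for z
  proof -
    have "(\<Sum>T\<in>Pow ?X. ?\<nu> z T) = (\<Sum>T\<in>Pow A. \<Sum>U\<in>Pow B. a z T * b z U)"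
      unfolding sum_Pow_Un[OF disj] by (intro sum.cong refl) (simp add: int)
    also have "\<dots> = (\<Sum>T\<in>Pow A. a z T) * (\<Sum>U\<in>Pow B. b z U)" by (simp add: sum_product)
    also have "\<dots> \<le> 1 * 1" by (intro mult_mono a1 b1 sum_nonneg a0) auto
    finally show ?thesis by simp
  qed
  let ?s = "\<lambda>z T U. of_bool (a z T < ?q U * \<beta>\<^sub>1 T) * (restr_coef ?X g z (T \<union> U))\<^sup>2"
  let ?t = "\<lambda>z U T. of_bool (b z U < ?q T * \<beta>\<^sub>2 U) * (restr_coef (B \<union> A) g z (U \<union> T))\<^sup>2"
  have pt: "of_bool (?\<nu> z (T \<union> U) < ?\<beta> (T \<union> U)) * (restr_coef ?X g z (T \<union> U))\<^sup>2 \<le> ?s z T U + ?t z U T"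
    if T: "T \<in> Pow A" and U: "U \<in> Pow B" for z T U
  proof -
    have "card (T \<union> U) = card T + card U"
      by (rule card_Un_disjoint) (use T U finA disj in \<open>auto intro: finite_subset\<close>)
    then have \<beta>eq: "?\<beta> (T \<union> U) = (?q U * \<beta>\<^sub>1 T) * (?q T * \<beta>\<^sub>2 U)"
      by (simp add: int[OF T U] power_add power4_eq_xxxx power2_eq_square)
    have "a z T < ?q U * \<beta>\<^sub>1 T \<or> b z U < ?q T * \<beta>\<^sub>2 U" if "?\<nu> z (T \<union> U) < ?\<beta> (T \<union> U)"
    proof (rule ccontr)
      assume "\<not> ?thesis"
      then have "(?q U * \<beta>\<^sub>1 T) * (?q T * \<beta>\<^sub>2 U) \<le> a z T * b z U"
        using \<beta>(1)[of T] \<beta>(2)[of U] a0 by (intro mult_mono) auto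
      with that show False unfolding \<beta>eq by (simp add: int[OF T U])
    qed
    then show ?thesis by (auto simp: Un_commute)
  qed
  have "avg (V - ?X) (\<lambda>z. \<Sum>T\<in>Pow ?X. of_bool (?\<nu> z T < ?\<beta> T) * (restr_coef ?X g z T)\<^sup>2) \<le>
    avg (V - ?X) (\<lambda>z. (\<Sum>T\<in>Pow A. \<Sum>U\<in>Pow B. ?s z T U) + (\<Sum>U\<in>Pow B. \<Sum>T\<in>Pow A. ?t z U T))"
  proof (rule avg_mono)
    fix z
    have "(\<Sum>T\<in>Pow ?X. of_bool (?\<nu> z T < ?\<beta> T) * (restr_coef ?X g z T)\<^sup>2) \<le>
      (\<Sum>T\<in>Pow A. \<Sum>U\<in>Pow B. ?s z T U + ?t z U T)"
      unfolding sum_Pow_Un[OF disj] by (intro sum_mono pt)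
    also have "\<dots> = (\<Sum>T\<in>Pow A. \<Sum>U\<in>Pow B. ?s z T U) + (\<Sum>U\<in>Pow B. \<Sum>T\<in>Pow A. ?t z U T)"
      by (simp only: sum.distrib sum.swap[of "\<lambda>T U. ?t z U T" "Pow B" "Pow A"])
    finally show "(\<Sum>T\<in>Pow ?X. of_bool (?\<nu> z T < ?\<beta> T) * (restr_coef ?X g z T)\<^sup>2) \<le>
      (\<Sum>T\<in>Pow A. \<Sum>U\<in>Pow B. ?s z T U) + (\<Sum>U\<in>Pow B. \<Sum>T\<in>Pow A. ?t z U T)" .
  qed
  also have "\<dots> = avg (V - ?X) (\<lambda>z. \<Sum>T\<in>Pow A. \<Sum>U\<in>Pow B. ?s z T U) +
    avg (V - (B \<union> A)) (\<lambda>z. \<Sum>U\<in>Pow B. \<Sum>T\<in>Pow A. ?t z U T)"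
    by (simp only: avg_add Un_commute)
  also have "\<dots> \<le> (2 * \<epsilon> * avg V (\<lambda>x. (g x)\<^sup>2) + 2 * e\<^sub>1) + (2 * \<epsilon> * avg V (\<lambda>x. (g x)\<^sup>2) + 2 * e\<^sub>2)"
    unfolding a_def b_def
    by (intro add_mono one_sided_weight fin sub disj eps \<beta> \<nu>1 \<nu>2) (use disj in auto)
  finally have err: "avg (V - ?X) (\<lambda>z. \<Sum>T\<in>Pow ?X. of_bool (?\<nu> z T < ?\<beta> T) * (restr_coef ?X g z T)\<^sup>2)
    \<le> 2 * e\<^sub>1 + 2 * e\<^sub>2 + 4 * \<epsilon> * avg V (\<lambda>x. (g x)\<^sup>2)" by simp
  show ?thesis
    unfolding concentrated_def
    by (rule exI[of _ ?\<nu>]) (use sum1 err a0 in auto)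
qed

section \<open>A single block\<close>

text \<open>With the factor 1/2 the squared derivatives sum to the Fourier form of the total
  influence (\<open>sum_influence\<close>). For a 0/1-valued function, \<open>influence\<close> is
  then a quarter of the probability that flipping \<open>i\<close> changes the value.\<close>

definition deriv_dir :: "('a set \<Rightarrow> real) \<Rightarrow> 'a \<Rightarrow> 'a set \<Rightarrow> real" where
  "deriv_dir g i x = (g x - g (insert i x)) / 2"

definition influence :: "'a set \<Rightarrow> ('a set \<Rightarrow> real) \<Rightarrow> 'a \<Rightarrow> real" where
  "influence V g i = avg (V - {i}) (\<lambda>x. (deriv_dir g i x)\<^sup>2)"

lemma sum_Pow_prod_le_exp:
  fixes p :: "'a \<Rightarrow> real"
  assumes "finite A" "\<And>i. i \<in> A \<Longrightarrow> 0 \<le> p i"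
  shows "(\<Sum>T\<in>Pow A. \<Prod>i\<in>T. p i) \<le> exp (\<Sum>i\<in>A. p i)"
proof -
  have "(\<Sum>T\<in>Pow A. \<Prod>i\<in>T. p i) = (\<Prod>i\<in>A. p i + 1)"
    using prod_add[OF assms(1), of p "\<lambda>_. 1"] by simp
  also have "\<dots> \<le> (\<Prod>i\<in>A. exp (p i))"
    using assms(2) by (intro prod_mono) (auto simp: add.commute add_nonneg_nonneg)
  also have "\<dots> = exp (\<Sum>i\<in>A. p i)" using assms(1) by (simp add: exp_sum)
  finally show ?thesis .
qed

lemma restr_coef_insert:
  assumes "finite J" "i \<in> J" "U \<subseteq> J - {i}"
  shows "restr_coef J g z (insert i U) = coef (J - {i}) (\<lambda>y. deriv_dir g i (z \<union> y)) U"
proof -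
  have "restr_coef (insert i (J - {i})) g z (insert i U) = coef (J - {i}) (\<lambda>y. deriv_dir g i (z \<union> y)) U"
    unfolding restr_coef_def using assms
    by (subst coef_insert) (auto simp: deriv_dir_def Un_commute insert_absorb)
  then show ?thesis using assms by (simp add: insert_absorb)
qed

text \<open>Friedgut's argument. Coefficients at sets through \<open>i\<close> are coefficients of
  the derivative in direction \<open>i\<close>, whose nonzero values are all 1/2 in modulus; its
  support thus has measure four times the restricted influence \<open>\<Gamma> z i\<close>. If some
  \<open>i\<close> in \<open>T\<close> has influence below \<open>\<delta> (card T)\<close>, then
  \<open>small_support_weight\<close> disposes of \<open>T\<close>. Otherwise all influences in
  \<open>T\<close> are large, and so is their normalised product \<open>\<nu> z T\<close>. Where the
  restricted total influence exceeds \<open>M\<close>, the whole weight, at most 1, is charged to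
  \<open>I z / M\<close>.\<close>

lemma concentrated_block:
  assumes fin: "finite V" and J: "J \<subseteq> V" and eps: "0 < \<epsilon>" and M: "0 < M"
    and d: "\<And>i x. i \<in> V \<Longrightarrow> x \<subseteq> V - {i} \<Longrightarrow> deriv_dir g i x \<in> {-1/2, 0, 1/2}"
    and g: "\<And>x. x \<subseteq> V \<Longrightarrow> \<bar>g x\<bar> \<le> 1"
  shows "concentrated V g J (\<lambda>T. 1 / 2 * (\<epsilon>\<^sup>2 / (32 * M)) ^ card T * (1 / 36) ^ (card T * card T))
    ((\<epsilon> + 1 / M) * (\<Sum>i\<in>J. influence V g i))"
proof -
  have finJ: "finite J" using fin J by (auto intro: finite_subset)
  define \<Gamma> where "\<Gamma> z i = avg (J - {i}) (\<lambda>y. (deriv_dir g i (z \<union> y))\<^sup>2)" for z i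
  define I where "I z = (\<Sum>i\<in>J. \<Gamma> z i)" for z
  \<comment> \<open>The weights \<open>\<Gamma> z i / (2 * I z)\<close> sum to at most 1/2, so their
    products over all \<open>T\<close> sum to at most \<open>exp (1 / 2)\<close>, and the leading
    1/2 brings the mass below 1. If \<open>I z = 0\<close>, division by zero yields 0 and only the
    empty set has mass.\<close>
  define \<nu> where "\<nu> z T = 1 / 2 * (\<Prod>i\<in>T. \<bar>\<Gamma> z i / (2 * I z)\<bar>)" for z T
  \<comment> \<open>Here \<open>r\<close> is the size of a set \<open>insert i U\<close>, and
    \<open>4 * \<delta> r\<close> must not exceed the bound of \<open>small_support_weight\<close>
    at \<open>card U = r - 1\<close>. The 4 converts influence into measure of support.\<close>
  define \<delta> where "\<delta> r = \<epsilon>\<^sup>2 / 16 * (1 / 36) ^ r" for r :: nat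
  let ?\<beta> = "\<lambda>T::'a set. 1 / 2 * (\<epsilon>\<^sup>2 / (32 * M)) ^ card T * (1 / 36) ^ (card T * card T)"
  have quarter: "of_bool (t \<noteq> 0) = 4 * t\<^sup>2" if "t \<in> {-1/2, 0, 1/2}" for t :: real
    using that by (elim insertE emptyE; hypsubst; simp add: power2_eq_square)
  have \<Gamma>0: "0 \<le> \<Gamma> z i" for z i unfolding \<Gamma>_def by (intro avg_nonneg) auto
  have I0: "0 \<le> I z" for z unfolding I_def by (intro sum_nonneg \<Gamma>0)
  have \<nu>0: "0 \<le> \<nu> z T" for z T unfolding \<nu>_def by (auto intro: prod_nonneg)
  have \<nu>1: "(\<Sum>T\<in>Pow J. \<nu> z T) \<le> 1" for z
  proof -
    have "(\<Sum>i\<in>J. \<bar>\<Gamma> z i / (2 * I z)\<bar>) = (\<Sum>i\<in>J. \<Gamma> z i / (2 * I z))"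
      using \<Gamma>0 I0 by (intro sum.cong) auto
    also have "\<dots> = I z / (2 * I z)" by (simp add: I_def sum_divide_distrib)
    also have "\<dots> \<le> 1 / 2" by simp
    finally have s: "(\<Sum>i\<in>J. \<bar>\<Gamma> z i / (2 * I z)\<bar>) \<le> 1 / 2" .
    have "(\<Sum>T\<in>Pow J. \<nu> z T) = 1 / 2 * (\<Sum>T\<in>Pow J. \<Prod>i\<in>T. \<bar>\<Gamma> z i / (2 * I z)\<bar>)"
      by (simp add: \<nu>_def sum_distrib_left)
    also have "\<dots> \<le> 1 / 2 * exp (\<Sum>i\<in>J. \<bar>\<Gamma> z i / (2 * I z)\<bar>)"
      by (intro mult_left_mono sum_Pow_prod_le_exp finJ) auto
    also have "\<dots> \<le> 1 / 2 * exp (1 / 2)" using s by simp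
    also have "\<dots> \<le> 1 / 2 * (1 + 1/2 + (1/2)\<^sup>2)"
      by (intro mult_left_mono exp_bound) auto
    also have "\<dots> \<le> 1" by (simp add: power2_eq_square)
    finally show ?thesis .
  qed
  have bad: "(\<Sum>T\<in>Pow J. of_bool (\<nu> z T < ?\<beta> T) * (restr_coef J g z T)\<^sup>2) \<le> (\<epsilon> + 1 / M) * I z"
    if z: "z \<subseteq> V - J" for z
  proof (cases "I z \<le> M")
    case False
    have "(\<Sum>T\<in>Pow J. of_bool (\<nu> z T < ?\<beta> T) * (restr_coef J g z T)\<^sup>2) \<le> (\<Sum>T\<in>Pow J. (restr_coef J g z T)\<^sup>2)"
      by (intro sum_mono) auto
    also have "\<dots> = avg J (\<lambda>x. (g (x \<union> z))\<^sup>2)" unfolding restr_coef_def by (rule parseval[OF finJ])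
    also have "\<dots> \<le> avg J (\<lambda>x. 1)"
    proof (rule avg_mono)
      fix x assume "x \<subseteq> J"
      then have "\<bar>g (x \<union> z)\<bar> \<le> 1" using z J by (intro g) auto
      then show "(g (x \<union> z))\<^sup>2 \<le> 1" by (simp add: abs_square_le_1)
    qed
    also have "\<dots> = 1" using finJ by (simp add: avg_const)
    also have "1 \<le> 1 / M * I z" using False M by (simp add: field_simps)
    also have "\<dots> \<le> (\<epsilon> + 1 / M) * I z" using eps I0 by (intro mult_right_mono) auto
    finally show ?thesis .
  next
    case True
    have "(\<Sum>T\<in>Pow J. of_bool (\<nu> z T < ?\<beta> T) * (restr_coef J g z T)\<^sup>2) \<le>
      (\<Sum>T\<in>Pow J. \<Sum>i\<in>J. of_bool (i \<in> T \<and> \<Gamma> z i < \<delta> (card T)) * (restr_coef J g z T)\<^sup>2)"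
    proof (rule sum_mono)
      fix T assume T: "T \<in> Pow J"
      have finT: "finite T" using T finJ by (auto intro: finite_subset)
      show "of_bool (\<nu> z T < ?\<beta> T) * (restr_coef J g z T)\<^sup>2 \<le>
        (\<Sum>i\<in>J. of_bool (i \<in> T \<and> \<Gamma> z i < \<delta> (card T)) * (restr_coef J g z T)\<^sup>2)"
      proof (cases "\<exists>i\<in>T. \<Gamma> z i < \<delta> (card T)")
        case True
        then obtain i where i: "i \<in> T" "\<Gamma> z i < \<delta> (card T)" by auto
        have "of_bool (\<nu> z T < ?\<beta> T) * (restr_coef J g z T)\<^sup>2 \<le>
          of_bool (i \<in> T \<and> \<Gamma> z i < \<delta> (card T)) * (restr_coef J g z T)\<^sup>2" using i by simp
        also have "\<dots> \<le> (\<Sum>i\<in>J. of_bool (i \<in> T \<and> \<Gamma> z i < \<delta> (card T)) * (restr_coef J g z T)\<^sup>2)"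
          by (rule member_le_sum) (use i T finJ in auto)
        finally show ?thesis .
      next
        case False
        \<comment> \<open>Each of the \<open>card T\<close> factors contains
          \<open>(1 / 36) ^ card T\<close>: this is the origin of the square in the
          exponent.\<close>
        have "?\<beta> T = 1 / 2 * (\<Prod>i\<in>T. \<delta> (card T) / (2 * M))"
          by (simp add: \<delta>_def power_mult_distrib power_divide power_mult field_simps)
        also have "\<dots> \<le> 1 / 2 * (\<Prod>i\<in>T. \<bar>\<Gamma> z i / (2 * I z)\<bar>)"
        proof (intro mult_left_mono prod_mono conjI)
          fix i assume i: "i \<in> T"
          have \<delta>0: "0 < \<delta> (card T)" using eps by (simp add: \<delta>_def)
          then show "0 \<le> \<delta> (card T) / (2 * M)" using M by simp
          have \<Gamma>: "\<delta> (card T) \<le> \<Gamma> z i" using False i by auto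
          have "\<Gamma> z i \<le> I z" unfolding I_def by (rule member_le_sum) (use i T finJ \<Gamma>0 in auto)
          then have "0 < I z" using \<Gamma> \<delta>0 by linarith
          then have "\<delta> (card T) / (2 * M) \<le> \<Gamma> z i / (2 * I z)"
            using \<Gamma> \<delta>0 True M by (intro frac_le) auto
          then show "\<delta> (card T) / (2 * M) \<le> \<bar>\<Gamma> z i / (2 * I z)\<bar>" by linarith
        qed simp
        finally have "\<not> \<nu> z T < ?\<beta> T" by (simp add: \<nu>_def)
        then show ?thesis by (simp add: sum_nonneg)
      qed
    qed
    also have "\<dots> = (\<Sum>i\<in>J. \<Sum>T\<in>Pow J. of_bool (i \<in> T \<and> \<Gamma> z i < \<delta> (card T)) * (restr_coef J g z T)\<^sup>2)"
      by (rule sum.swap)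
    also have "\<dots> \<le> (\<Sum>i\<in>J. \<epsilon> * \<Gamma> z i)"
    proof (rule sum_mono)
      fix i assume i: "i \<in> J"
      let ?h = "\<lambda>T. of_bool (i \<in> T \<and> \<Gamma> z i < \<delta> (card T)) * (restr_coef J g z T)\<^sup>2"
      let ?F = "\<lambda>y. deriv_dir g i (z \<union> y)"
      define P where "P = {U\<in>Pow (J - {i}). \<Gamma> z i < \<delta> (Suc (card U))}"
      have "(\<Sum>T\<in>Pow J. ?h T) = (\<Sum>T\<in>Pow (insert i (J - {i})). ?h T)"
        using i by (simp add: insert_absorb)
      also have "\<dots> = (\<Sum>U\<in>Pow (J - {i}). ?h U + ?h (insert i U))" by (rule sum_Pow_insert) simp
      also have "\<dots> = (\<Sum>U\<in>Pow (J - {i}). if \<Gamma> z i < \<delta> (Suc (card U)) then (coef (J - {i}) ?F U)\<^sup>2 else 0)"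
      proof (intro sum.cong refl)
        fix U assume U: "U \<in> Pow (J - {i})"
        then have "i \<notin> U" "finite U" using finJ by (auto intro: finite_subset)
        then show "?h U + ?h (insert i U) = (if \<Gamma> z i < \<delta> (Suc (card U)) then (coef (J - {i}) ?F U)\<^sup>2 else 0)"
          using U by (simp add: restr_coef_insert[OF finJ i])
      qed
      also have "\<dots> = (\<Sum>U\<in>P. (coef (J - {i}) ?F U)\<^sup>2)"
        unfolding P_def by (rule sum.inter_filter[symmetric]) (use finJ in simp)
      also have "\<dots> \<le> \<epsilon> * avg (J - {i}) (\<lambda>y. (?F y)\<^sup>2)"
      proof (rule small_support_weight)
        fix U assume U: "U \<in> P"
        have "avg (J - {i}) (\<lambda>y. of_bool (?F y \<noteq> 0)) = avg (J - {i}) (\<lambda>y. 4 * (?F y)\<^sup>2)"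
        proof (rule avg_cong)
          fix y assume "y \<subseteq> J - {i}"
          then have "?F y \<in> {-1/2, 0, 1/2}" using i z J by (intro d) auto
          then show "of_bool (?F y \<noteq> 0) = 4 * (?F y)\<^sup>2" by (rule quarter)
        qed
        also have "\<dots> = 4 * \<Gamma> z i" by (simp add: avg_cmult \<Gamma>_def)
        also have "\<dots> \<le> 4 * \<delta> (Suc (card U))" using U by (simp add: P_def)
        also have "\<dots> \<le> \<epsilon>\<^sup>2 / 4 * (1 / 36) ^ card U" by (simp add: \<delta>_def field_simps)
        finally show "avg (J - {i}) (\<lambda>y. of_bool (?F y \<noteq> 0)) \<le> \<epsilon>\<^sup>2 / 4 * (1 / 36) ^ card U" .
      qed (use finJ eps in \<open>auto simp: P_def\<close>)
      finally show "(\<Sum>T\<in>Pow J. ?h T) \<le> \<epsilon> * \<Gamma> z i" by (simp add: \<Gamma>_def)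
    qed
    also have "\<dots> = \<epsilon> * I z" by (simp add: I_def sum_distrib_left)
    also have "\<dots> \<le> (\<epsilon> + 1 / M) * I z" using M I0 by (intro mult_right_mono) auto
    finally show ?thesis .
  qed
  have "avg (V - J) (\<lambda>z. \<Sum>T\<in>Pow J. of_bool (\<nu> z T < ?\<beta> T) * (restr_coef J g z T)\<^sup>2) \<le>
    avg (V - J) (\<lambda>z. (\<epsilon> + 1 / M) * I z)"
    by (intro avg_mono bad)
  also have "\<dots> = (\<epsilon> + 1 / M) * (\<Sum>i\<in>J. avg (V - J) (\<lambda>z. \<Gamma> z i))"
    by (simp add: avg_cmult I_def avg_sum)
  also have "(\<Sum>i\<in>J. avg (V - J) (\<lambda>z. \<Gamma> z i)) = (\<Sum>i\<in>J. influence V g i)"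
  proof (intro sum.cong refl)
    fix i assume i: "i \<in> J"
    have "avg ((V - J) \<union> (J - {i})) (\<lambda>x. (deriv_dir g i x)\<^sup>2) = avg (V - J) (\<lambda>z. \<Gamma> z i)"
      unfolding \<Gamma>_def by (rule avg_Un) (use fin finJ in auto)
    moreover have "(V - J) \<union> (J - {i}) = V - {i}" using i J by auto
    ultimately show "avg (V - J) (\<lambda>z. \<Gamma> z i) = influence V g i" by (simp add: influence_def)
  qed
  finally show ?thesis
    unfolding concentrated_def by (intro exI[of _ \<nu>]) (use \<nu>0 \<nu>1 in auto)
qed

section \<open>Merging along the binary tree of colours\<close>

definition same_colour :: "('a \<Rightarrow> nat) \<Rightarrow> 'a set \<Rightarrow> nat" where
  "same_colour col T = card {(u, v)\<in>T \<times> T. col u = col v}"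

text \<open>Ordered pairs are counted and the diagonal is included, so \<open>same_colour\<close> is
  the sum of the squares of the sizes of the colour classes of \<open>T\<close>, exactly what the
  blocks pay. Additivity lets this cost pass unchanged through the merges.\<close>

lemma same_colour_Un:
  assumes "finite A" "finite B" "\<And>u v. u \<in> A \<Longrightarrow> v \<in> B \<Longrightarrow> col u \<noteq> col v"
  shows "same_colour col (A \<union> B) = same_colour col A + same_colour col B"
proof -
  have "{(u, v)\<in>(A \<union> B) \<times> (A \<union> B). col u = col v} =
    {(u, v)\<in>A \<times> A. col u = col v} \<union> {(u, v)\<in>B \<times> B. col u = col v}"
    using assms(3) by (auto dest: sym)
  moreover have "card ({(u, v)\<in>A \<times> A. col u = col v} \<union> {(u, v)\<in>B \<times> B. col u = col v}) =
    card {(u, v)\<in>A \<times> A. col u = col v} + card {(u, v)\<in>B \<times> B. col u = col v}"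
  proof (rule card_Un_disjoint)
    show "finite {(u, v)\<in>A \<times> A. col u = col v}"
      by (rule finite_subset[of _ "A \<times> A"]) (use assms in auto)
    show "finite {(u, v)\<in>B \<times> B. col u = col v}"
      by (rule finite_subset[of _ "B \<times> B"]) (use assms in auto)
  qed (use assms(3) in fastforce)
  ultimately show ?thesis by (simp add: same_colour_def)
qed

lemma same_colour_const:
  assumes "\<And>u. u \<in> T \<Longrightarrow> col u = j"
  shows "same_colour col T = card T * card T"
proof -
  have "{(u, v)\<in>T \<times> T. col u = col v} = T \<times> T" using assms by auto
  then show ?thesis by (simp add: same_colour_def card_cartesian_product)
qed

lemma concentrated_cong:
  assumes "concentrated V g X \<beta> e" "\<And>T. T \<subseteq> X \<Longrightarrow> \<beta> T = \<beta>' T" "e \<le> e'"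
  shows "concentrated V g X \<beta>' e'"
proof -
  have "(\<Sum>T\<in>Pow X. of_bool (\<nu> z T < \<beta> T) * (restr_coef X g z T)\<^sup>2) =
    (\<Sum>T\<in>Pow X. of_bool (\<nu> z T < \<beta>' T) * (restr_coef X g z T)\<^sup>2)" for \<nu> z
    using assms(2) by (intro sum.cong) auto
  note eq = this
  obtain \<nu> where \<nu>: "\<forall>z T. 0 \<le> \<nu> z T" "\<forall>z. (\<Sum>T\<in>Pow X. \<nu> z T) \<le> 1"
    "avg (V - X) (\<lambda>z. \<Sum>T\<in>Pow X. of_bool (\<nu> z T < \<beta> T) * (restr_coef X g z T)\<^sup>2) \<le> e"
    using assms(1) unfolding concentrated_def by (elim exE conjE)
  show ?thesis
    unfolding concentrated_def
    by (rule exI[of _ \<nu>], intro conjI \<nu>(1,2)) (use \<nu>(3) assms(3) in \<open>simp only: eq\<close>)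
qed

text \<open>A node of height \<open>l\<close> unites \<open>2 ^ l\<close> consecutive colours, and
  its children have quotients \<open>2 * j\<close> and \<open>2 * j + 1\<close>. The threshold
  collects \<open>\<epsilon> ^ 4 / 16\<close> from each of the \<open>2 ^ l - 1\<close> merges, 1/2
  from each leaf, 1/36 per element of \<open>T\<close> and level, and the squares from the leaves. A
  merge doubles the errors of both children: influences add up, whence the factor
  \<open>2 ^ l\<close>, while the norm term grows by \<open>x -> 4 x + 4\<close> in units of
  \<open>\<epsilon> N\<close>, which \<open>2 * (4 ^ l - 1)\<close> dominates.\<close>

lemma concentrated_tree:
  assumes fin: "finite V" and eps: "0 < \<epsilon>" and M: "0 < M"
    and d: "\<And>i x. i \<in> V \<Longrightarrow> x \<subseteq> V - {i} \<Longrightarrow> deriv_dir g i x \<in> {-1/2, 0, 1/2}"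
    and g: "\<And>x. x \<subseteq> V \<Longrightarrow> \<bar>g x\<bar> \<le> 1"
  shows "concentrated V g {v\<in>V. col v div 2 ^ l = j}
    (\<lambda>T. (\<epsilon> ^ 4 / 16) ^ (2 ^ l - 1) * (1 / 2) ^ (2 ^ l) *
       (\<epsilon>\<^sup>2 / (32 * M) * (1 / 36) ^ l) ^ card T * (1 / 36) ^ same_colour col T)
    (2 ^ l * (\<epsilon> + 1 / M) * (\<Sum>i | i \<in> V \<and> col i div 2 ^ l = j. influence V g i) +
       2 * (4 ^ l - 1) * \<epsilon> * avg V (\<lambda>x. (g x)\<^sup>2))"
proof (induction l arbitrary: j)
  case 0
  let ?J = "{v\<in>V. col v div 2 ^ 0 = j}"
  have "concentrated V g ?J (\<lambda>T. 1 / 2 * (\<epsilon>\<^sup>2 / (32 * M)) ^ card T * (1 / 36) ^ (card T * card T))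
    ((\<epsilon> + 1 / M) * (\<Sum>i\<in>?J. influence V g i))"
    by (rule concentrated_block[OF fin _ eps M d g]) auto
  then show ?case
  proof (rule concentrated_cong)
    fix T assume "T \<subseteq> ?J"
    then have "same_colour col T = card T * card T" by (intro same_colour_const[of _ _ j]) auto
    then show "1 / 2 * (\<epsilon>\<^sup>2 / (32 * M)) ^ card T * (1 / 36) ^ (card T * card T) =
      (\<epsilon> ^ 4 / 16) ^ (2 ^ 0 - 1) * (1 / 2) ^ (2 ^ 0) *
       (\<epsilon>\<^sup>2 / (32 * M) * (1 / 36) ^ 0) ^ card T * (1 / 36) ^ same_colour col T" by simp
  qed simp_all
next
  case (Suc l)
  let ?A = "{v\<in>V. col v div 2 ^ l = 2 * j}" and ?B = "{v\<in>V. col v div 2 ^ l = Suc (2 * j)}"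
  let ?X = "{v\<in>V. col v div 2 ^ Suc l = j}"
  let ?I = "\<lambda>X. \<Sum>i\<in>X. influence V g i"
  let ?N = "avg V (\<lambda>x. (g x)\<^sup>2)"
  let ?K = "\<epsilon>\<^sup>2 / (32 * M)"
  have X: "?X = ?A \<union> ?B"
  proof -
    have "col v div 2 ^ Suc l = (col v div 2 ^ l) div 2" for v
      by (simp only: power_Suc2 div_mult2_eq)
    then show ?thesis by auto
  qed
  have finA: "finite ?A" "finite ?B" using fin by auto
  have conc: "concentrated V g (?A \<union> ?B)
    (\<lambda>T. \<epsilon> ^ 4 / 16 * (1 / 36) ^ card T *
       ((\<epsilon> ^ 4 / 16) ^ (2 ^ l - 1) * (1 / 2) ^ (2 ^ l) * (?K * (1 / 36) ^ l) ^ card (T \<inter> ?A) * (1 / 36) ^ same_colour col (T \<inter> ?A)) *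
       ((\<epsilon> ^ 4 / 16) ^ (2 ^ l - 1) * (1 / 2) ^ (2 ^ l) * (?K * (1 / 36) ^ l) ^ card (T \<inter> ?B) * (1 / 36) ^ same_colour col (T \<inter> ?B)))
    (2 * (2 ^ l * (\<epsilon> + 1 / M) * ?I ?A + 2 * (4 ^ l - 1) * \<epsilon> * ?N) +
     2 * (2 ^ l * (\<epsilon> + 1 / M) * ?I ?B + 2 * (4 ^ l - 1) * \<epsilon> * ?N) + 4 * \<epsilon> * ?N)"
    by (rule concentrated_Un[OF fin _ _ _ eps _ _ Suc.IH Suc.IH]) (use eps M in auto)
  show ?case
    unfolding X
  proof (rule concentrated_cong[OF conc])
    fix T assume T: "T \<subseteq> ?A \<union> ?B"
    have finT: "finite (T \<inter> ?A)" "finite (T \<inter> ?B)" using finA by auto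
    have TT: "T = (T \<inter> ?A) \<union> (T \<inter> ?B)" using T by auto
    have c: "card T = card (T \<inter> ?A) + card (T \<inter> ?B)"
      by (subst TT, rule card_Un_disjoint) (use finT in auto)
    have s: "same_colour col T = same_colour col (T \<inter> ?A) + same_colour col (T \<inter> ?B)"
      by (subst TT, rule same_colour_Un) (use finT in auto)
    have "2 ^ Suc l - 1 = Suc ((2 ^ l - 1) + (2 ^ l - 1 :: nat))"
      using one_le_power[of "2::nat" l] unfolding power_Suc by linarith
    then have k: "(\<epsilon> ^ 4 / 16) ^ (2 ^ Suc l - 1) =
        \<epsilon> ^ 4 / 16 * ((\<epsilon> ^ 4 / 16) ^ (2 ^ l - 1) * (\<epsilon> ^ 4 / 16) ^ (2 ^ l - 1))"
      by (simp only: power_Suc power_add)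
    have h: "(1 / 2 :: real) ^ (2 ^ Suc l) = (1 / 2) ^ (2 ^ l) * (1 / 2) ^ (2 ^ l)"
      unfolding power_add[symmetric] power_Suc mult_2 ..
    have p: "(?K * (1 / 36) ^ Suc l) ^ card T = (1 / 36) ^ card T * (?K * (1 / 36) ^ l) ^ card T"
      unfolding power_mult_distrib[symmetric] power_Suc by (simp only: mult.left_commute)
    show "\<epsilon> ^ 4 / 16 * (1 / 36) ^ card T *
       ((\<epsilon> ^ 4 / 16) ^ (2 ^ l - 1) * (1 / 2) ^ (2 ^ l) * (?K * (1 / 36) ^ l) ^ card (T \<inter> ?A) * (1 / 36) ^ same_colour col (T \<inter> ?A)) *
       ((\<epsilon> ^ 4 / 16) ^ (2 ^ l - 1) * (1 / 2) ^ (2 ^ l) * (?K * (1 / 36) ^ l) ^ card (T \<inter> ?B) * (1 / 36) ^ same_colour col (T \<inter> ?B)) =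
      (\<epsilon> ^ 4 / 16) ^ (2 ^ Suc l - 1) * (1 / 2) ^ (2 ^ Suc l) *
       (?K * (1 / 36) ^ Suc l) ^ card T * (1 / 36) ^ same_colour col T"
      unfolding k h p unfolding s c power_add by (simp only: mult_ac)
  next
    have "?I (?A \<union> ?B) = ?I ?A + ?I ?B"
      by (rule sum.union_disjoint) (use finA in auto)
    moreover have "0 \<le> \<epsilon> * ?N" using eps by (intro mult_nonneg_nonneg avg_nonneg) auto
    ultimately show "2 * (2 ^ l * (\<epsilon> + 1 / M) * ?I ?A + 2 * (4 ^ l - 1) * \<epsilon> * ?N) +
     2 * (2 ^ l * (\<epsilon> + 1 / M) * ?I ?B + 2 * (4 ^ l - 1) * \<epsilon> * ?N) + 4 * \<epsilon> * ?N \<le>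
     2 ^ Suc l * (\<epsilon> + 1 / M) * sum (influence V g) (?A \<union> ?B) + 2 * (4 ^ Suc l - 1) * \<epsilon> * ?N"
      by (simp add: algebra_simps)
  qed
qed

section \<open>Colourings\<close>

text \<open>A random colouring made greedy: a new element takes a colour for which its weight to the
  elements already coloured is at most the average over the \<open>m\<close> colours.\<close>

lemma balanced_colouring:
  fixes w :: "'a \<Rightarrow> 'a \<Rightarrow> real"
  assumes "finite V" "0 < m"
  shows "\<exists>col. (\<forall>v. col v < m) \<and>
    (\<Sum>u\<in>V. \<Sum>v\<in>V. of_bool (u \<noteq> v \<and> col u = col v) * w u v) \<le>
    (\<Sum>u\<in>V. \<Sum>v\<in>V. of_bool (u \<noteq> v) * w u v) / real m"
  using assms(1)
proof (induction V)
  case empty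
  show ?case using assms(2) by (intro exI[of _ "\<lambda>_. 0"]) auto
next
  case (insert x V)
  obtain col where col: "\<forall>v. col v < m"
    "(\<Sum>u\<in>V. \<Sum>v\<in>V. of_bool (u \<noteq> v \<and> col u = col v) * w u v) \<le>
    (\<Sum>u\<in>V. \<Sum>v\<in>V. of_bool (u \<noteq> v) * w u v) / real m"
    using insert.IH by blast
  define S where "S = (\<Sum>v\<in>V. w x v + w v x)"
  define s where "s k = (\<Sum>v\<in>V. of_bool (col v = k) * (w x v + w v x))" for k
  have "(\<Sum>k<m. s k) = (\<Sum>v\<in>V. \<Sum>k<m. of_bool (col v = k) * (w x v + w v x))"
    unfolding s_def by (rule sum.swap)
  also have "\<dots> = S" unfolding S_def
  proof (rule sum.cong[OF refl])
    fix v
    have "(\<Sum>k<m. of_bool (col v = k) * (w x v + w v x)) = (\<Sum>k<m. if k = col v then w x v + w v x else 0)"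
      by (intro sum.cong) auto
    then show "(\<Sum>k<m. of_bool (col v = k) * (w x v + w v x)) = w x v + w v x" using col(1) by simp
  qed
  finally have sS: "(\<Sum>k<m. s k) = S" .
  have "\<exists>k<m. s k \<le> S / real m"
  proof (rule ccontr)
    assume "\<not> ?thesis"
    then have "(\<Sum>k<m. S / real m) < (\<Sum>k<m. s k)"
      using assms(2) by (intro sum_strict_mono) auto
    then show False using assms(2) sS by simp
  qed
  then obtain k where k: "k < m" "s k \<le> S / real m" by auto
  have expand: "(\<Sum>u\<in>insert x V. \<Sum>v\<in>insert x V. h u v) =
    h x x + (\<Sum>v\<in>V. h x v + h v x) + (\<Sum>u\<in>V. \<Sum>v\<in>V. h u v)" for h :: "'a \<Rightarrow> 'a \<Rightarrow> real"
    using insert(1,2) by (simp add: sum.distrib)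
  let ?col = "col(x := k)"
  have "(\<Sum>u\<in>insert x V. \<Sum>v\<in>insert x V. of_bool (u \<noteq> v \<and> ?col u = ?col v) * w u v) =
    s k + (\<Sum>u\<in>V. \<Sum>v\<in>V. of_bool (u \<noteq> v \<and> col u = col v) * w u v)"
    unfolding expand
  proof (intro arg_cong2[where f = "(+)"])
    have "(\<Sum>v\<in>V. of_bool (x \<noteq> v \<and> ?col x = ?col v) * w x v + of_bool (v \<noteq> x \<and> ?col v = ?col x) * w v x) = s k"
      unfolding s_def using insert(2) by (intro sum.cong refl) (auto simp: distrib_left)
    then show "of_bool (x \<noteq> x \<and> ?col x = ?col x) * w x x +
      (\<Sum>v\<in>V. of_bool (x \<noteq> v \<and> ?col x = ?col v) * w x v + of_bool (v \<noteq> x \<and> ?col v = ?col x) * w v x) = s k"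
      by simp
    show "(\<Sum>u\<in>V. \<Sum>v\<in>V. of_bool (u \<noteq> v \<and> ?col u = ?col v) * w u v) =
      (\<Sum>u\<in>V. \<Sum>v\<in>V. of_bool (u \<noteq> v \<and> col u = col v) * w u v)"
    proof (rule sum.cong[OF refl], rule sum.cong[OF refl])
      fix u v assume "u \<in> V" "v \<in> V"
      then have "u \<noteq> x" "v \<noteq> x" using insert(2) by auto
      then show "of_bool (u \<noteq> v \<and> ?col u = ?col v) * w u v = of_bool (u \<noteq> v \<and> col u = col v) * w u v"
        by simp
    qed
  qed
  also have "\<dots> \<le> (S + (\<Sum>u\<in>V. \<Sum>v\<in>V. of_bool (u \<noteq> v) * w u v)) / real m"
    using k(2) col(2) by (simp add: add_divide_distrib)
  also have "S + (\<Sum>u\<in>V. \<Sum>v\<in>V. of_bool (u \<noteq> v) * w u v) =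
    (\<Sum>u\<in>insert x V. \<Sum>v\<in>insert x V. of_bool (u \<noteq> v) * w u v)"
  proof -
    have "S = (\<Sum>v\<in>V. of_bool (x \<noteq> v) * w x v + of_bool (v \<noteq> x) * w v x)"
      unfolding S_def using insert(2) by (intro sum.cong refl) auto
    then show ?thesis unfolding expand by simp
  qed
  finally have le: "(\<Sum>u\<in>insert x V. \<Sum>v\<in>insert x V. of_bool (u \<noteq> v \<and> ?col u = ?col v) * w u v) \<le>
    (\<Sum>u\<in>insert x V. \<Sum>v\<in>insert x V. of_bool (u \<noteq> v) * w u v) / real m" .
  show ?case
  proof (rule exI[of _ ?col], rule conjI)
    show "\<forall>v. ?col v < m" using col(1) k(1) by simp
  qed (rule le)
qed

lemma same_colour_split:
  assumes "finite T"
  shows "real (same_colour col T) = real (card T) + (\<Sum>u\<in>T. \<Sum>v\<in>T. of_bool (u \<noteq> v \<and> col u = col v))"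
proof -
  have "same_colour col T = (\<Sum>p\<in>T \<times> T. of_bool (col (fst p) = col (snd p)))"
  proof -
    have "{(u, v)\<in>T \<times> T. col u = col v} = {p\<in>T \<times> T. col (fst p) = col (snd p)}" by auto
    then show ?thesis using assms by (simp add: same_colour_def of_bool_def sum.If_cases Int_def)
  qed
  then have "real (same_colour col T) = (\<Sum>u\<in>T. \<Sum>v\<in>T. of_bool (col u = col v))"
    by (simp add: sum.cartesian_product split_def)
  also have "\<dots> = (\<Sum>u\<in>T. \<Sum>v\<in>T. of_bool (u = v) + of_bool (u \<noteq> v \<and> col u = col v))"
    by (intro sum.cong refl) auto
  also have "\<dots> = (\<Sum>u\<in>T. \<Sum>v\<in>T. of_bool (u = v)) + (\<Sum>u\<in>T. \<Sum>v\<in>T. of_bool (u \<noteq> v \<and> col u = col v))"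
    by (simp add: sum.distrib)
  also have "(\<Sum>u\<in>T. \<Sum>v\<in>T. of_bool (u = v)) = (\<Sum>u\<in>T. (1::real))"
    using assms by (intro sum.cong refl) (simp add: of_bool_def)
  finally show ?thesis by simp
qed

lemma sum_swap_pairs:
  fixes c :: "'a set \<Rightarrow> real"
  assumes "finite V" "\<P> \<subseteq> Pow V"
  shows "(\<Sum>u\<in>V. \<Sum>v\<in>V. h u v * (\<Sum>T\<in>\<P>. of_bool (u \<in> T \<and> v \<in> T) * c T)) =
    (\<Sum>T\<in>\<P>. c T * (\<Sum>u\<in>T. \<Sum>v\<in>T. h u v))"
proof -
  have "(\<Sum>u\<in>V. \<Sum>v\<in>V. h u v * (\<Sum>T\<in>\<P>. of_bool (u \<in> T \<and> v \<in> T) * c T)) =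
    (\<Sum>u\<in>V. \<Sum>v\<in>V. \<Sum>T\<in>\<P>. c T * (of_bool (u \<in> T) * (of_bool (v \<in> T) * h u v)))"
    unfolding sum_distrib_left by (intro sum.cong refl) auto
  also have "\<dots> = (\<Sum>u\<in>V. \<Sum>T\<in>\<P>. \<Sum>v\<in>V. c T * (of_bool (u \<in> T) * (of_bool (v \<in> T) * h u v)))"
    by (rule sum.cong, rule refl, rule sum.swap)
  also have "\<dots> = (\<Sum>T\<in>\<P>. \<Sum>u\<in>V. \<Sum>v\<in>V. c T * (of_bool (u \<in> T) * (of_bool (v \<in> T) * h u v)))"
    by (rule sum.swap)
  also have "\<dots> = (\<Sum>T\<in>\<P>. c T * (\<Sum>u\<in>V. of_bool (u \<in> T) * (\<Sum>v\<in>V. of_bool (v \<in> T) * h u v)))"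
    by (simp add: sum_distrib_left)
  also have "\<dots> = (\<Sum>T\<in>\<P>. c T * (\<Sum>u\<in>T. \<Sum>v\<in>T. h u v))"
  proof (rule sum.cong[OF refl])
    fix T assume "T \<in> \<P>"
    then have TV: "V \<inter> T = T" using assms(2) by auto
    have r: "(\<Sum>v\<in>V. of_bool (v \<in> T) * k v) = (\<Sum>v\<in>T. k v)" for k :: "'a \<Rightarrow> real"
    proof -
      have "(\<Sum>v\<in>V. of_bool (v \<in> T) * k v) = (\<Sum>v\<in>V. if v \<in> T then k v else 0)"
        by (intro sum.cong) auto
      also have "\<dots> = (\<Sum>v\<in>V \<inter> T. k v)" using assms(1) by (simp add: sum.inter_restrict)
      finally show ?thesis by (simp add: TV)
    qed
    show "c T * (\<Sum>u\<in>V. of_bool (u \<in> T) * (\<Sum>v\<in>V. of_bool (v \<in> T) * h u v)) =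
      c T * (\<Sum>u\<in>T. \<Sum>v\<in>T. h u v)"
      by (simp only: r)
  qed
  finally show ?thesis .
qed

text \<open>Give a pair the total \<open>c\<close>-weight of the sets containing it and colour by
  \<open>balanced_colouring\<close>. Pairs of distinct elements then cost on average at most
  \<open>|T|^2 / m <= |T|\<close> per set, and the diagonal costs another \<open>|T|\<close>; hence
  the 2.\<close>

lemma few_collisions_colouring:
  fixes c :: "'a set \<Rightarrow> real"
  assumes fin: "finite V" and m: "0 < m" and c: "\<And>T. 0 \<le> c T"
  shows "\<exists>col. (\<forall>v. col v < m) \<and>
    (\<Sum>T | T \<subseteq> V \<and> card T \<le> m. c T * real (same_colour col T)) \<le> 2 * (\<Sum>T\<in>Pow V. real (card T) * c T)"
proof -
  define \<P> where "\<P> = {T. T \<subseteq> V \<and> card T \<le> m}"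
  have P: "\<P> \<subseteq> Pow V" by (auto simp: \<P>_def)
  have finT: "finite T" if "T \<in> \<P>" for T using that fin by (auto simp: \<P>_def intro: finite_subset)
  define w where "w u v = (\<Sum>T\<in>\<P>. of_bool (u \<in> T \<and> v \<in> T) * c T)" for u v
  obtain col where col: "\<forall>v. col v < m"
    "(\<Sum>u\<in>V. \<Sum>v\<in>V. of_bool (u \<noteq> v \<and> col u = col v) * w u v) \<le>
    (\<Sum>u\<in>V. \<Sum>v\<in>V. of_bool (u \<noteq> v) * w u v) / real m"
    using balanced_colouring[OF fin m, of w] by blast
  have "(\<Sum>T\<in>\<P>. c T * real (same_colour col T)) =
    (\<Sum>T\<in>\<P>. real (card T) * c T) + (\<Sum>T\<in>\<P>. c T * (\<Sum>u\<in>T. \<Sum>v\<in>T. of_bool (u \<noteq> v \<and> col u = col v)))"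
    unfolding sum.distrib[symmetric]
    by (intro sum.cong refl) (simp add: same_colour_split[OF finT] algebra_simps)
  also have "(\<Sum>T\<in>\<P>. c T * (\<Sum>u\<in>T. \<Sum>v\<in>T. of_bool (u \<noteq> v \<and> col u = col v))) \<le>
    (\<Sum>T\<in>\<P>. c T * (\<Sum>u\<in>T. \<Sum>v\<in>T. of_bool (u \<noteq> v))) / real m"
    using col(2) unfolding w_def sum_swap_pairs[OF fin P] .
  also have "\<dots> \<le> (\<Sum>T\<in>\<P>. real (card T) * c T)"
    unfolding sum_divide_distrib
  proof (rule sum_mono)
    fix T assume T: "T \<in> \<P>"
    have "(\<Sum>u\<in>T. \<Sum>v\<in>T. of_bool (u \<noteq> v)) \<le> (\<Sum>u\<in>T. \<Sum>v\<in>T. (1::real))"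
      by (intro sum_mono) auto
    also have "\<dots> = real (card T) * real (card T)" by simp
    also have "\<dots> \<le> real (card T) * real m" using T by (intro mult_left_mono) (auto simp: \<P>_def)
    finally have "c T * (\<Sum>u\<in>T. \<Sum>v\<in>T. of_bool (u \<noteq> v)) \<le> c T * (real (card T) * real m)"
      by (intro mult_left_mono c)
    then show "c T * (\<Sum>u\<in>T. \<Sum>v\<in>T. of_bool (u \<noteq> v)) / real m \<le> real (card T) * c T"
      using m by (simp add: field_simps)
  qed
  also have "(\<Sum>T\<in>\<P>. real (card T) * c T) \<le> (\<Sum>T\<in>Pow V. real (card T) * c T)"
    using fin P c by (intro sum_mono2) auto
  finally show ?thesis using col(1) unfolding \<P>_def by (intro exI[of _ col]) auto
qed

lemma sum_influence:
  assumes fin: "finite V"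
  shows "(\<Sum>i\<in>V. influence V g i) = (\<Sum>T\<in>Pow V. real (card T) * (coef V g T)\<^sup>2)"
proof -
  have inf: "influence V g i = (\<Sum>T\<in>Pow V. of_bool (i \<in> T) * (coef V g T)\<^sup>2)" if i: "i \<in> V" for i
  proof -
    have not_in: "i \<notin> V - {i}" by simp
    have "(\<Sum>T\<in>Pow V. of_bool (i \<in> T) * (coef V g T)\<^sup>2) =
      (\<Sum>T\<in>Pow (insert i (V - {i})). of_bool (i \<in> T) * (coef (insert i (V - {i})) g T)\<^sup>2)"
      using i by (simp add: insert_absorb)
    also have "\<dots> = (\<Sum>U\<in>Pow (V - {i}). (coef (V - {i}) (deriv_dir g i) U)\<^sup>2)"
      unfolding sum_Pow_insert[OF not_in]
    proof (rule sum.cong[OF refl])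
      fix U assume "U \<in> Pow (V - {i})"
      then have U: "U \<subseteq> V - {i}" "i \<notin> U" by auto
      have "coef (insert i (V - {i})) g (insert i U) = coef (V - {i}) (deriv_dir g i) U"
        unfolding deriv_dir_def[abs_def] using fin U by (intro coef_insert(2)) auto
      then show "of_bool (i \<in> U) * (coef (insert i (V - {i})) g U)\<^sup>2 +
         of_bool (i \<in> insert i U) * (coef (insert i (V - {i})) g (insert i U))\<^sup>2 =
         (coef (V - {i}) (deriv_dir g i) U)\<^sup>2"
        using U by (simp del: insert_Diff_single)
    qed
    also have "\<dots> = influence V g i"
      unfolding influence_def by (rule parseval) (use fin in simp)
    finally show ?thesis ..
  qed
  have "(\<Sum>i\<in>V. influence V g i) = (\<Sum>i\<in>V. \<Sum>T\<in>Pow V. of_bool (i \<in> T) * (coef V g T)\<^sup>2)"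
    by (intro sum.cong refl inf)
  also have "\<dots> = (\<Sum>T\<in>Pow V. \<Sum>i\<in>V. of_bool (i \<in> T) * (coef V g T)\<^sup>2)" by (rule sum.swap)
  also have "\<dots> = (\<Sum>T\<in>Pow V. real (card T) * (coef V g T)\<^sup>2)"
  proof (rule sum.cong[OF refl])
    fix T assume "T \<in> Pow V"
    then have "V \<inter> T = T" by auto
    then have "(\<Sum>i\<in>V. of_bool (i \<in> T) :: real) = real (card T)" using fin by (simp add: of_bool_def sum.If_cases)
    then show "(\<Sum>i\<in>V. of_bool (i \<in> T) * (coef V g T)\<^sup>2) = real (card T) * (coef V g T)\<^sup>2"
      by (simp add: sum_distrib_right[symmetric])
  qed
  finally show ?thesis .
qed

section \<open>The weight on small coefficients\<close>

lemma sum_of_bool_Pow: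
  fixes c :: "'a set \<Rightarrow> real"
  assumes "finite V"
  shows "(\<Sum>T\<in>Pow V. of_bool (P T) * c T) = (\<Sum>T | T \<subseteq> V \<and> P T. c T)"
proof -
  have "(\<Sum>T | T \<subseteq> V \<and> P T. c T) = (\<Sum>T\<in>{T\<in>Pow V. P T}. c T)" by (simp add: Pow_def)
  also have "\<dots> = (\<Sum>T\<in>Pow V. if P T then c T else 0)"
    by (rule sum.inter_filter) (use assms in simp)
  also have "\<dots> = (\<Sum>T\<in>Pow V. of_bool (P T) * c T)" by (intro sum.cong) auto
  finally show ?thesis ..
qed

text \<open>Four kinds of sets: those with more than \<open>m\<close> elements, those with more than
  \<open>2 m\<close> equally coloured pairs, those below the threshold of the tree, and the rest.
  Markov's inequality for the size and for the collisions, and the tree error, each cost at most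
  \<open>N / h\<close>. On the rest \<open>\<nu> T >= b\<close>, so there are at most
  \<open>1 / b\<close> such sets, and each contributes at most \<open>\<theta>^2\<close>.\<close>

lemma small_coef_weight:
  fixes L h :: nat and \<theta> :: real
  defines "m \<equiv> 2 ^ L"
  assumes fin: "finite V" and h: "1 \<le> h"
    and d: "\<And>i x. i \<in> V \<Longrightarrow> x \<subseteq> V - {i} \<Longrightarrow> deriv_dir g i x \<in> {-1/2, 0, 1/2}"
    and g: "\<And>x. x \<subseteq> V \<Longrightarrow> \<bar>g x\<bar> \<le> 1"
    and I: "real h * (\<Sum>T\<in>Pow V. real (card T) * (coef V g T)\<^sup>2) \<le> m * avg V (\<lambda>x. (g x)\<^sup>2)"
  shows "(\<Sum>T\<in>Pow V. of_bool (\<bar>coef V g T\<bar> \<le> \<theta>) * (coef V g T)\<^sup>2) \<le>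
    3 * avg V (\<lambda>x. (g x)\<^sup>2) / h + \<theta>\<^sup>2 * (1327104 * (4 * real h) ^ 7 * m ^ 20) ^ (2 ^ L)"
proof -
  define k :: nat where "k = 2 ^ L"
  have m: "m = real k" by (simp add: m_def k_def)
  have k: "1 \<le> k" by (simp add: k_def)
  have m1: "1 \<le> m" using k by (simp add: m)
  define N where "N = avg V (\<lambda>x. (g x)\<^sup>2)"
  define c where "c T = (coef V g T)\<^sup>2" for T
  define J where "J = (\<Sum>T\<in>Pow V. real (card T) * c T)"
  \<comment> \<open>With \<open>M = 1 / \<epsilon>\<close> the two error terms of a block are equal
    and the tree error is at most \<open>4 m^2 \<epsilon> N\<close>; this \<open>\<epsilon>\<close>
    makes it \<open>N / h\<close>.\<close>
  define \<epsilon> where "\<epsilon> = 1 / (4 * real h * m\<^sup>2)"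
  define M where "M = 1 / \<epsilon>"
  have c0: "0 \<le> c T" for T by (simp add: c_def)
  have J0: "0 \<le> J" unfolding J_def by (intro sum_nonneg) (simp add: c0)
  have N0: "0 \<le> N" unfolding N_def by (intro avg_nonneg) simp
  have JN: "J / m \<le> N / h" using I m1 h unfolding J_def N_def c_def by (simp add: field_simps)
  have hm1: "1 \<le> 4 * real h * m\<^sup>2"
  proof -
    have "1 * 1 \<le> real h * m\<^sup>2" using h m1 by (intro mult_mono) auto
    then show ?thesis by simp
  qed
  have eps: "0 < \<epsilon>" "\<epsilon> \<le> 1" using hm1 by (auto simp: \<epsilon>_def)
  have M0: "0 < M" using eps by (simp add: M_def)
  obtain col where col: "\<forall>v. col v < k"
    "(\<Sum>T | T \<subseteq> V \<and> card T \<le> k. c T * real (same_colour col T)) \<le> 2 * J"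
    using few_collisions_colouring[of V k c] fin k c0 unfolding J_def by auto
  \<comment> \<open>All colours are below \<open>2 ^ L\<close>, so the root of the tree is all of
    \<open>V\<close>.\<close>
  have X: "{v\<in>V. col v div 2 ^ L = 0} = V" using col(1) by (auto simp: k_def)
  define \<beta> where "\<beta> T = (\<epsilon> ^ 4 / 16) ^ (k - 1) * (1 / 2) ^ k *
       (\<epsilon>\<^sup>2 / (32 * M) * (1 / 36) ^ L) ^ card T * (1 / 36) ^ same_colour col T" for T
  define e where "e = 2 ^ L * (\<epsilon> + 1 / M) * J + 2 * (4 ^ L - 1) * \<epsilon> * N"
  have "concentrated V g V \<beta> e"
    using concentrated_tree[OF fin eps(1) M0 d g, of col L 0]
    unfolding X \<beta>_def[abs_def] e_def k_def N_def J_def c_def sum_influence[OF fin, symmetric] by simp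
  then obtain \<nu>' where \<nu>': "\<And>z T. 0 \<le> \<nu>' z T" "\<And>z. (\<Sum>T\<in>Pow V. \<nu>' z T) \<le> 1"
    "avg (V - V) (\<lambda>z. \<Sum>T\<in>Pow V. of_bool (\<nu>' z T < \<beta> T) * (restr_coef V g z T)\<^sup>2) \<le> e"
    unfolding concentrated_def by blast
  define \<nu> where "\<nu> = \<nu>' {}"
  have \<nu>: "0 \<le> \<nu> T" "(\<Sum>T\<in>Pow V. \<nu> T) \<le> 1" "(\<Sum>T\<in>Pow V. of_bool (\<nu> T < \<beta> T) * c T) \<le> e" for T
    using \<nu>' by (simp_all add: \<nu>_def restr_coef_def c_def)
  have e: "e \<le> N / h"
  proof -
    have "(4::real) ^ L = m\<^sup>2" by (simp add: m_def power2_eq_square flip: power_mult_distrib)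
    then have "e = 2 * \<epsilon> * m\<^sup>2 * (J / m) + 2 * (m\<^sup>2 - 1) * \<epsilon> * N"
      using m1 by (simp add: e_def M_def m_def[symmetric] power2_eq_square)
    also have "\<dots> \<le> 2 * \<epsilon> * m\<^sup>2 * N + 2 * m\<^sup>2 * \<epsilon> * N"
    proof (intro add_mono mult_left_mono mult_right_mono)
      have "N / h \<le> N / 1" using N0 h by (intro divide_left_mono) auto
      then show "J / m \<le> N" using JN by simp
    qed (use eps N0 in auto)
    also have "\<dots> = 4 * m\<^sup>2 * \<epsilon> * N" by simp
    also have "\<dots> = N / h" using m1 h by (simp add: \<epsilon>_def field_simps)
    finally show ?thesis .
  qed
  \<comment> \<open>A lower bound for \<open>\<beta>\<close> at its worst admissible
    \<open>T\<close>, with \<open>card T = k\<close> and \<open>2 * k\<close> equally coloured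
    pairs. Taking every exponent as a multiple of \<open>k\<close> makes \<open>1 / b\<close> a
    single \<open>k\<close>-th power.\<close>
  define b where "b = (\<epsilon> ^ 4 / 16) ^ k * (1 / 2) ^ k * (\<epsilon> ^ 3 / 32 * (1 / 36) ^ L) ^ k * (1 / 36) ^ (2 * k)"
  have b0: "0 < b" using eps by (simp add: b_def)
  have \<beta>b: "b \<le> \<beta> T" if "card T \<le> k" "same_colour col T \<le> 2 * k" for T
  proof -
    have K: "\<epsilon>\<^sup>2 / (32 * M) = \<epsilon> ^ 3 / 32" by (simp add: M_def power2_eq_square power3_eq_cube)
    have e34: "\<epsilon> ^ 4 \<le> 1" "\<epsilon> ^ 3 \<le> 1" using eps by (auto intro: power_le_one)
    have "\<epsilon> ^ 3 / 32 * (1 / 36) ^ L \<le> 1 * 1"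
      using e34 eps by (intro mult_mono power_le_one) auto
    then show ?thesis
      unfolding b_def \<beta>_def K using that e34 eps
      by (intro mult_mono power_decreasing mult_nonneg_nonneg) auto
  qed
  have pt: "of_bool (\<bar>coef V g T\<bar> \<le> \<theta>) * c T \<le>
    real (card T) * c T / m + of_bool (card T \<le> k) * (c T * real (same_colour col T)) / (2 * m) +
    of_bool (\<nu> T < \<beta> T) * c T + \<theta>\<^sup>2 / b * \<nu> T" for T
  proof -
    have nn: "0 \<le> real (card T) * c T / m"
      "0 \<le> of_bool (card T \<le> k) * (c T * real (same_colour col T)) / (2 * m)"
      "0 \<le> of_bool (\<nu> T < \<beta> T) * c T" "0 \<le> \<theta>\<^sup>2 / b * \<nu> T"
      using c0 m1 b0 \<nu>(1) by auto
    have le: "of_bool (\<bar>coef V g T\<bar> \<le> \<theta>) * c T \<le> c T" using c0 by auto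
    consider "k < card T" | "card T \<le> k" "2 * k < same_colour col T" | "\<nu> T < \<beta> T"
      | "card T \<le> k" "same_colour col T \<le> 2 * k" "\<beta> T \<le> \<nu> T" by linarith
    then show ?thesis
    proof cases
      case 1
      then have "c T * m \<le> c T * real (card T)" using c0 m by (intro mult_left_mono) auto
      then have "c T \<le> real (card T) * c T / m" using m1 by (simp add: field_simps)
      then show ?thesis using nn le by linarith
    next
      case 2
      then have "c T * (2 * m) \<le> c T * real (same_colour col T)" using c0 m by (intro mult_left_mono) auto
      then have "c T \<le> of_bool (card T \<le> k) * (c T * real (same_colour col T)) / (2 * m)"
        using m1 2 by (simp add: field_simps)
      then show ?thesis using nn le by linarith
    next
      case 3
      then have "c T \<le> of_bool (\<nu> T < \<beta> T) * c T" by simp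
      then show ?thesis using nn le by linarith
    next
      case 4
      then have "b \<le> \<nu> T" using \<beta>b[of T] by linarith
      then have "1 \<le> \<nu> T / b" using b0 by simp
      have "of_bool (\<bar>coef V g T\<bar> \<le> \<theta>) * c T \<le> \<theta>\<^sup>2"
        by (auto simp: c_def abs_le_square_iff[symmetric])
      also have "\<dots> = \<theta>\<^sup>2 * 1" by simp
      also have "\<dots> \<le> \<theta>\<^sup>2 * (\<nu> T / b)" using \<open>1 \<le> \<nu> T / b\<close> by (intro mult_left_mono) auto
      finally show ?thesis using nn by (simp add: field_simps)
    qed
  qed
  have "(\<Sum>T\<in>Pow V. of_bool (\<bar>coef V g T\<bar> \<le> \<theta>) * c T) \<le> (\<Sum>T\<in>Pow V.
    real (card T) * c T / m + of_bool (card T \<le> k) * (c T * real (same_colour col T)) / (2 * m) +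
    of_bool (\<nu> T < \<beta> T) * c T + \<theta>\<^sup>2 / b * \<nu> T)"
    by (intro sum_mono pt)
  also have "\<dots> = J / m + (\<Sum>T | T \<subseteq> V \<and> card T \<le> k. c T * real (same_colour col T)) / (2 * m) +
    (\<Sum>T\<in>Pow V. of_bool (\<nu> T < \<beta> T) * c T) + \<theta>\<^sup>2 / b * (\<Sum>T\<in>Pow V. \<nu> T)"
    unfolding sum_of_bool_Pow[OF fin, symmetric] sum.distrib J_def sum_divide_distrib sum_distrib_left ..
  also have "\<dots> \<le> N / h + N / h + N / h + \<theta>\<^sup>2 / b * 1"
  proof (intro add_mono mult_left_mono JN \<nu>(2))
    have "(\<Sum>T | T \<subseteq> V \<and> card T \<le> k. c T * real (same_colour col T)) / (2 * m) \<le> (2 * J) / (2 * m)"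
      using col(2) m1 by (intro divide_right_mono) auto
    also have "\<dots> = J / m" by simp
    finally show "(\<Sum>T | T \<subseteq> V \<and> card T \<le> k. c T * real (same_colour col T)) / (2 * m) \<le> N / h"
      using JN by linarith
    show "(\<Sum>T\<in>Pow V. of_bool (\<nu> T < \<beta> T) * c T) \<le> N / h" using \<nu>(3) e by linarith
    show "0 \<le> \<theta>\<^sup>2 / b" using b0 by simp
  qed
  also have "\<theta>\<^sup>2 / b \<le> \<theta>\<^sup>2 * (1327104 * (4 * real h) ^ 7 * m ^ 20) ^ k"
  proof -
    \<comment> \<open>The constant is \<open>16 * 2 * 32 * 1296\<close>. In the next step
      \<open>36 ^ L <= 64 ^ L = m ^ 6\<close> and \<open>\<epsilon> ^ 7\<close> in the denominator
      supplies \<open>m ^ 14\<close>, which explains \<open>m ^ 20\<close>.\<close>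
    have "1 / b = (1327104 * 36 ^ L / \<epsilon> ^ 7) ^ k"
    proof -
      have sq: "(1 / 36 :: real) ^ (2 * k) = (1 / 1296) ^ k"
        unfolding power_mult by (simp add: power2_eq_square)
      have "b = (\<epsilon> ^ 4 / 16 * (1 / 2) * (\<epsilon> ^ 3 / 32 * (1 / 36) ^ L) * (1 / 1296)) ^ k"
        unfolding b_def sq power_mult_distrib ..
      then have "1 / b = (1 / (\<epsilon> ^ 4 / 16 * (1 / 2) * (\<epsilon> ^ 3 / 32 * (1 / 36) ^ L) * (1 / 1296))) ^ k"
        by (simp only: power_one_over)
      also have "1 / (\<epsilon> ^ 4 / 16 * (1 / 2) * (\<epsilon> ^ 3 / 32 * (1 / 36) ^ L) * (1 / 1296)) =
          1327104 * 36 ^ L / (\<epsilon> ^ 4 * \<epsilon> ^ 3)"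
        by (simp add: power_one_over)
      also have "\<epsilon> ^ 4 * \<epsilon> ^ 3 = \<epsilon> ^ 7" by (simp flip: power_add)
      finally show ?thesis .
    qed
    also have "\<dots> \<le> (1327104 * (4 * real h) ^ 7 * m ^ 20) ^ k"
    proof (rule power_mono)
      have "(36::real) ^ L \<le> 64 ^ L" by (intro power_mono) auto
      also have "\<dots> = m ^ 6" by (simp add: m_def power_mult[symmetric] mult.commute[of L]) (simp add: power_mult)
      finally have m6: "36 ^ L \<le> m ^ 6" .
      have "1 / \<epsilon> ^ 7 = (4 * real h) ^ 7 * m ^ 14"
        by (simp add: \<epsilon>_def power_divide power_mult_distrib flip: power_mult)
      then have "1327104 * 36 ^ L / \<epsilon> ^ 7 = 1327104 * 36 ^ L * ((4 * real h) ^ 7 * m ^ 14)"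
        by (metis divide_inverse inverse_eq_divide)
      also have "\<dots> \<le> 1327104 * m ^ 6 * ((4 * real h) ^ 7 * m ^ 14)"
        using m6 m1 by (intro mult_right_mono mult_left_mono) auto
      also have "\<dots> = 1327104 * (4 * real h) ^ 7 * (m ^ 6 * m ^ 14)" by (simp only: mult_ac)
      finally show "1327104 * 36 ^ L / \<epsilon> ^ 7 \<le> 1327104 * (4 * real h) ^ 7 * m ^ 20"
        by (simp flip: power_add)
    qed (use eps in simp)
    finally have "\<theta>\<^sup>2 * (1 / b) \<le> \<theta>\<^sup>2 * (1327104 * (4 * real h) ^ 7 * m ^ 20) ^ k"
      by (rule mult_left_mono) simp
    then show ?thesis by simp
  qed
  finally show ?thesis unfolding c_def N_def k_def by simp
qed

section \<open>Boolean functions: centring and a lower bound on the variance\<close>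

lemma coef_empty: "coef V g {} = avg V g"
  by (simp add: coef_def walsh_def)

lemma coef_add_const:
  assumes "finite V" "T \<subseteq> V" "T \<noteq> {}"
  shows "coef V (\<lambda>x. g x + c) T = coef V g T"
proof -
  obtain i where i: "i \<in> T" using assms(3) by auto
  have "coef (insert i (V - {i})) (\<lambda>x. c) (insert i (T - {i})) = coef (V - {i}) (\<lambda>x. (c - c) / 2) (T - {i})"
    by (rule coef_insert(2)) (use assms in auto)
  then have "coef V (\<lambda>x. c) T = 0"
    using assms i by (simp add: insert_absorb subset_iff coef_def avg_def)
  then show ?thesis by (simp add: coef_add)
qed

lemma coef_uminus: "coef V (\<lambda>x. - g x) T = - coef V g T"
  using avg_cmult[of V "-1" "\<lambda>x. g x * walsh T x"] by (simp add: coef_def)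

lemma sum_Pow_nonempty:
  fixes c :: "'a set \<Rightarrow> real"
  assumes "finite V"
  shows "(\<Sum>T\<in>Pow V. c T) = c {} + (\<Sum>T\<in>Pow V - {{}}. c T)"
  by (rule sum.remove) (use assms in auto)

text \<open>A Boolean function of small mean \<open>p\<close> has support of measure
  \<open>p\<close>, so its weight up to level \<open>m\<close> is of order at most
  \<open>3^m * p^(3/2)\<close>. The influence bound puts at least half of the variance there by
  Markov's inequality, and the variance is at least \<open>p / 2\<close>. Comparing the two forces
  \<open>6 * 3^m * sqrt p >= 1\<close>.\<close>

lemma variance_lower_bound_aux:
  assumes fin: "finite V" and F: "\<And>x. x \<subseteq> V \<Longrightarrow> F x \<in> {0, 1}"
    and half: "avg V F \<le> 1 / 2" and pos: "0 < avg V F - (avg V F)\<^sup>2" and m: "1 \<le> m"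
    and I: "2 * (\<Sum>T\<in>Pow V. real (card T) * (coef V F T)\<^sup>2) \<le> real m * (avg V F - (avg V F)\<^sup>2)"
  shows "1 \<le> 288 * 9 ^ m * (avg V F - (avg V F)\<^sup>2)"
proof -
  define p where "p = avg V F"
  define c where "c T = (coef V F T)\<^sup>2" for T
  have F2: "avg V (\<lambda>x. (F x)\<^sup>2) = p"
    unfolding p_def by (rule avg_cong) (drule F, auto)
  have p0: "0 \<le> p" using F2 avg_nonneg[of V "\<lambda>x. (F x)\<^sup>2"] by simp
  have "p \<noteq> 0" using pos unfolding p_def[symmetric] by auto
  then have p: "0 < p" using p0 by simp
  have tot: "(\<Sum>T\<in>Pow V. c T) = p" unfolding c_def parseval[OF fin] F2 ..
  have nonempty: "(\<Sum>T\<in>Pow V - {{}}. c T) = p - p\<^sup>2"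
    using tot sum_Pow_nonempty[OF fin, of c] by (simp add: c_def coef_empty p_def)
  have "(\<Sum>T\<in>Pow V - {{}}. c T) \<le>
    (\<Sum>T\<in>Pow V - {{}}. of_bool (card T \<le> m) * c T + real (card T) * c T / m)"
  proof (rule sum_mono)
    fix T
    show "c T \<le> of_bool (card T \<le> m) * c T + real (card T) * c T / m"
    proof (cases "card T \<le> m")
      case True
      then show ?thesis by (simp add: c_def)
    next
      case False
      then have "real m * c T \<le> real (card T) * c T" by (intro mult_right_mono) (auto simp: c_def)
      then show ?thesis using m False by (simp add: field_simps)
    qed
  qed
  also have "\<dots> \<le> (\<Sum>T\<in>Pow V. of_bool (card T \<le> m) * c T + real (card T) * c T / m)"
    by (intro sum_mono2) (auto simp: fin c_def)
  also have "\<dots> = (\<Sum>T\<in>Pow V. of_bool (card T \<le> m) * c T) + (\<Sum>T\<in>Pow V. real (card T) * c T) / m"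
    by (simp add: sum.distrib sum_divide_distrib)
  also have "(\<Sum>T\<in>Pow V. real (card T) * c T) / m \<le> (p - p\<^sup>2) / 2"
    using I m by (simp add: c_def p_def field_simps)
  finally have "p - p\<^sup>2 \<le> (\<Sum>T\<in>Pow V. of_bool (card T \<le> m) * c T) + (p - p\<^sup>2) / 2"
    unfolding nonempty by simp
  moreover have "a / 2 \<le> s" if "a \<le> s + a / 2" for a s :: real using that by linarith
  ultimately have low: "(p - p\<^sup>2) / 2 \<le> (\<Sum>T\<in>Pow V. of_bool (card T \<le> m) * c T)" by blast
  have "(\<Sum>T\<in>Pow V. of_bool (card T \<le> m) * c T) = (\<Sum>T | T \<subseteq> V \<and> card T \<le> m. c T)"
    by (rule sum_of_bool_Pow[OF fin])
  also have "\<dots> = (\<Sum>j\<le>m. \<Sum>T | T \<in> {T. T \<subseteq> V \<and> card T \<le> m} \<and> card T = j. c T)"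
    by (rule sum.group[symmetric]) (use fin in auto)
  also have "\<dots> = (\<Sum>j\<le>m. \<Sum>T | T \<subseteq> V \<and> card T = j. c T)"
    by (intro sum.cong) auto
  also have "\<dots> \<le> (\<Sum>j\<le>m. 3 ^ j * sqrt p * p)"
  proof (rule sum_mono)
    fix j
    have "avg V (\<lambda>y. of_bool (F y \<noteq> 0)) \<le> p"
      unfolding p_def by (rule avg_mono) (drule F, auto)
    then show "(\<Sum>T | T \<subseteq> V \<and> card T = j. c T) \<le> 3 ^ j * sqrt p * p"
      unfolding c_def using level_small_support[OF fin, of F p j] F2 by simp
  qed
  also have "\<dots> = (\<Sum>j\<le>m. 3 ^ j) * (sqrt p * p)" by (simp add: sum_distrib_right mult.assoc)
  also have "\<dots> \<le> 3 * 3 ^ m / 2 * (sqrt p * p)"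
  proof (rule mult_right_mono)
    have "2 * (\<Sum>j\<le>m. (3::real) ^ j) = 3 ^ Suc m - 1" by (induction m) auto
    then show "(\<Sum>j\<le>m. (3::real) ^ j) \<le> 3 * 3 ^ m / 2" by simp
  qed (use p in simp)
  finally have up: "(p - p\<^sup>2) / 2 \<le> 3 * 3 ^ m / 2 * (sqrt p * p)" using low by linarith
  have pv: "p / 2 \<le> p - p\<^sup>2"
  proof -
    have "p * p \<le> p * (1 / 2)" using half p by (intro mult_left_mono) (auto simp: p_def)
    then show ?thesis by (simp add: power2_eq_square)
  qed
  have "p * (1 / 4) \<le> p * (3 * 3 ^ m / 2 * sqrt p)" using up pv by (simp add: mult_ac)
  then have "1 / 4 \<le> 3 * 3 ^ m / 2 * sqrt p" using p by (simp only: mult_le_cancel_left_pos)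
  then have "1 \<le> 6 * 3 ^ m * sqrt p" by simp
  then have "1\<^sup>2 \<le> (6 * 3 ^ m * sqrt p)\<^sup>2" by (intro power_mono) auto
  also have "\<dots> = 36 * 9 ^ m * p"
  proof -
    have "(3 ^ m :: real)\<^sup>2 = 9 ^ m" by (simp add: power2_eq_square flip: power_mult_distrib)
    then show ?thesis using p by (simp add: power_mult_distrib)
  qed
  also have "\<dots> \<le> 36 * 9 ^ m * (2 * (p - p\<^sup>2))" using pv by (intro mult_left_mono) auto
  also have "\<dots> \<le> 288 * 9 ^ m * (p - p\<^sup>2)" using pv p by simp
  finally show ?thesis by (simp add: p_def)
qed

text \<open>Complementing \<open>F\<close> preserves the variance and, up to sign, all nonempty
  coefficients, so the mean may be taken to be at most 1/2.\<close>

lemma variance_lower_bound: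
  assumes fin: "finite V" and F: "\<And>x. x \<subseteq> V \<Longrightarrow> F x \<in> {0, 1}"
    and pos: "0 < avg V F - (avg V F)\<^sup>2" and m: "1 \<le> m"
    and I: "2 * (\<Sum>T\<in>Pow V. real (card T) * (coef V F T)\<^sup>2) \<le> real m * (avg V F - (avg V F)\<^sup>2)"
  shows "1 \<le> 288 * 9 ^ m * (avg V F - (avg V F)\<^sup>2)"
proof (cases "avg V F \<le> 1 / 2")
  case True
  then show ?thesis using variance_lower_bound_aux[OF fin F _ pos m I] by blast
next
  case False
  define G where "G x = - F x + 1" for x
  have aG: "avg V G = 1 - avg V F"
    using avg_diff[of V "\<lambda>x. 1" F] by (simp add: G_def[abs_def] avg_const[OF fin] add.commute)
  have v: "avg V G - (avg V G)\<^sup>2 = avg V F - (avg V F)\<^sup>2"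
    unfolding aG by (simp add: power2_eq_square algebra_simps)
  have "(\<Sum>T\<in>Pow V. real (card T) * (coef V G T)\<^sup>2) = (\<Sum>T\<in>Pow V. real (card T) * (coef V F T)\<^sup>2)"
  proof (rule sum.cong[OF refl])
    fix T assume "T \<in> Pow V"
    then have "coef V G T = coef V (\<lambda>x. - F x) T" if "T \<noteq> {}"
      unfolding G_def[abs_def] using that by (intro coef_add_const[OF fin]) auto
    then show "real (card T) * (coef V G T)\<^sup>2 = real (card T) * (coef V F T)\<^sup>2"
      by (cases "T = {}") (simp_all add: coef_uminus)
  qed
  note IG = this
  have "1 \<le> 288 * 9 ^ m * (avg V G - (avg V G)\<^sup>2)"
  proof (rule variance_lower_bound_aux[OF fin _ _ _ m])
    show "G x \<in> {0, 1}" if "x \<subseteq> V" for x using F[OF that] by (auto simp: G_def)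
    show "avg V G \<le> 1 / 2" using False by (simp add: aG)
    show "0 < avg V G - (avg V G)\<^sup>2" using pos by (simp only: v)
    show "2 * (\<Sum>T\<in>Pow V. real (card T) * (coef V G T)\<^sup>2) \<le> real m * (avg V G - (avg V G)\<^sup>2)"
      using I by (simp only: v IG)
  qed
  then show ?thesis by (simp only: v)
qed

text \<open>Subtracting the mean turns the squared norm into the variance and affects neither
  derivatives nor nonempty coefficients. The empty coefficient of \<open>F\<close> counts only if it
  is at most \<open>\<theta>\<close> in modulus; it then adds at most \<open>\<theta>^2\<close>,
  which doubles the additive error. \<open>variance_lower_bound\<close> converts that error into at
  most \<open>v / h\<close>.\<close>

lemma small_coef_weight_boolean:
  fixes L h :: nat and \<theta> :: real
  assumes fin: "finite V" and h: "2 \<le> h" and F: "\<And>x. x \<subseteq> V \<Longrightarrow> F x \<in> {0, 1}"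
    and v: "v = avg V (\<lambda>x. (F x)\<^sup>2) - (avg V F)\<^sup>2" and pos: "0 < v"
    and I: "real h * (\<Sum>T\<in>Pow V. real (card T) * (coef V F T)\<^sup>2) \<le> 2 ^ L * v"
    and \<theta>: "\<theta>\<^sup>2 * (2 * real h * 2592 * 1327104 * (4 * real h) ^ 7 * (2 ^ L) ^ 20) ^ (2 ^ L) \<le> 1"
  shows "(\<Sum>T\<in>Pow V. (coef V F T)\<^sup>2 * of_bool (\<bar>coef V F T\<bar> \<le> \<theta>)) \<le> 4 * v / h"
proof -
  define p where "p = avg V F"
  define g where "g x = F x + - p" for x
  define k :: nat where "k = 2 ^ L"
  have k: "1 \<le> k" by (simp add: k_def)
  define K where "K = 1327104 * (4 * real h) ^ 7 * (2 ^ L) ^ 20"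
  have F2: "avg V (\<lambda>x. (F x)\<^sup>2) = p"
    unfolding p_def by (rule avg_cong) (drule F, auto)
  have v': "v = p - p\<^sup>2" using v F2 by (simp add: p_def)
  have p01: "0 \<le> p" "p \<le> 1"
  proof -
    show "0 \<le> p" unfolding p_def by (rule avg_nonneg) (drule F, auto)
    have "p \<le> avg V (\<lambda>x. 1)" unfolding p_def by (rule avg_mono) (drule F, auto)
    then show "p \<le> 1" by (simp add: avg_const fin)
  qed
  have g1: "\<bar>g x\<bar> \<le> 1" if "x \<subseteq> V" for x using F[OF that] p01 by (auto simp: g_def)
  have d: "deriv_dir g i x \<in> {-1/2, 0, 1/2}" if "i \<in> V" "x \<subseteq> V - {i}" for i x
  proof -
    have "F x \<in> {0, 1}" by (rule F) (use that in auto)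
    moreover have "F (insert i x) \<in> {0, 1}" by (rule F) (use that in auto)
    ultimately show ?thesis by (auto simp: deriv_dir_def g_def)
  qed
  have N: "avg V (\<lambda>x. (g x)\<^sup>2) = v"
  proof -
    have "avg V (\<lambda>x. (g x)\<^sup>2) = avg V (\<lambda>x. (F x)\<^sup>2 + (- 2 * p) * F x + p\<^sup>2)"
      by (intro avg_cong) (simp add: g_def power2_eq_square algebra_simps)
    also have "\<dots> = p + (- 2 * p) * p + p\<^sup>2"
      unfolding avg_add avg_cmult avg_const[OF fin] F2 p_def ..
    finally show ?thesis by (simp add: v' power2_eq_square)
  qed
  have cg: "coef V g T = coef V F T" if "T \<subseteq> V" "T \<noteq> {}" for T
    unfolding g_def[abs_def] by (rule coef_add_const[OF fin that])
  have Ig: "(\<Sum>T\<in>Pow V. real (card T) * (coef V g T)\<^sup>2) = (\<Sum>T\<in>Pow V. real (card T) * (coef V F T)\<^sup>2)"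
  proof (rule sum.cong[OF refl])
    fix T assume "T \<in> Pow V"
    then show "real (card T) * (coef V g T)\<^sup>2 = real (card T) * (coef V F T)\<^sup>2"
      by (cases "T = {}") (auto simp: cg)
  qed
  have sg: "(\<Sum>T\<in>Pow V. of_bool (\<bar>coef V g T\<bar> \<le> \<theta>) * (coef V g T)\<^sup>2) \<le> 3 * v / h + \<theta>\<^sup>2 * K ^ k"
    using small_coef_weight[OF fin _ d g1, of h L \<theta>] h I by (simp add: N Ig K_def k_def)
  have K1: "1 \<le> K ^ k"
  proof (rule one_le_power)
    have "1 * 1 * 1 \<le> 1327104 * (4 * real h) ^ 7 * (2 ^ L) ^ 20"
      using h by (intro mult_mono one_le_power) auto
    then show "1 \<le> K" by (simp add: K_def)
  qed
  have "(\<Sum>T\<in>Pow V. (coef V F T)\<^sup>2 * of_bool (\<bar>coef V F T\<bar> \<le> \<theta>)) =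
    (coef V F {})\<^sup>2 * of_bool (\<bar>coef V F {}\<bar> \<le> \<theta>) +
    (\<Sum>T\<in>Pow V - {{}}. of_bool (\<bar>coef V g T\<bar> \<le> \<theta>) * (coef V g T)\<^sup>2)"
    unfolding sum_Pow_nonempty[OF fin] by (intro arg_cong2[where f = "(+)"] sum.cong refl) (auto simp: cg)
  also have "(coef V F {})\<^sup>2 * of_bool (\<bar>coef V F {}\<bar> \<le> \<theta>) \<le> \<theta>\<^sup>2"
    by (auto simp: abs_le_square_iff[symmetric])
  also have "\<theta>\<^sup>2 \<le> \<theta>\<^sup>2 * K ^ k" using K1 by (simp add: mult_le_cancel_left1)
  also have "(\<Sum>T\<in>Pow V - {{}}. of_bool (\<bar>coef V g T\<bar> \<le> \<theta>) * (coef V g T)\<^sup>2) \<le>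
    (\<Sum>T\<in>Pow V. of_bool (\<bar>coef V g T\<bar> \<le> \<theta>) * (coef V g T)\<^sup>2)"
    by (intro sum_mono2) (auto simp: fin)
  also note sg
  finally have main: "(\<Sum>T\<in>Pow V. (coef V F T)\<^sup>2 * of_bool (\<bar>coef V F T\<bar> \<le> \<theta>)) \<le>
    3 * v / h + 2 * (\<theta>\<^sup>2 * K ^ k)" by (simp add: mult.commute add.commute)
  have v1: "1 \<le> 288 * 9 ^ k * v"
    unfolding v' p_def
  proof (rule variance_lower_bound[OF fin F _ k])
    show "0 < avg V F - (avg V F)\<^sup>2" using pos v' by (simp add: p_def)
    have "2 * (\<Sum>T\<in>Pow V. real (card T) * (coef V F T)\<^sup>2) \<le> real h * (\<Sum>T\<in>Pow V. real (card T) * (coef V F T)\<^sup>2)"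
      using h by (intro mult_right_mono sum_nonneg) auto
    also note I
    finally show "2 * (\<Sum>T\<in>Pow V. real (card T) * (coef V F T)\<^sup>2) \<le> real k * (avg V F - (avg V F)\<^sup>2)"
      by (simp add: k_def v' p_def)
  qed
  have "2 * real h * (\<theta>\<^sup>2 * K ^ k) \<le> 2 * real h * (\<theta>\<^sup>2 * K ^ k) * (288 * 9 ^ k * v)"
    using mult_left_mono[OF v1, of "2 * real h * (\<theta>\<^sup>2 * K ^ k)"] K1 by simp
  also have "\<dots> = \<theta>\<^sup>2 * ((2 * real h) * (288 * 9 ^ k) * K ^ k) * v" by simp
  \<comment> \<open>The constants are raised to the power \<open>k\<close> to merge everything into
    the single power bounded by the hypothesis on \<open>\<theta>\<close>;
    \<open>2592 = 288 * 9\<close>.\<close>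
  also have "\<dots> \<le> \<theta>\<^sup>2 * ((2 * real h) ^ k * 2592 ^ k * K ^ k) * v"
  proof (intro mult_right_mono mult_left_mono mult_mono)
    show "2 * real h \<le> (2 * real h) ^ k" using h k by (intro self_le_power) auto
    have "288 \<le> (288::real) ^ k" using k by (intro self_le_power) auto
    then have "288 * 9 ^ k \<le> (288::real) ^ k * 9 ^ k" by (intro mult_right_mono) auto
    then show "288 * 9 ^ k \<le> (2592::real) ^ k" by (simp flip: power_mult_distrib)
  qed (use pos K1 h in auto)
  also have "(2 * real h) ^ k * 2592 ^ k * K ^ k = (2 * real h * 2592 * 1327104 * (4 * real h) ^ 7 * (2 ^ L) ^ 20) ^ (2 ^ L)"
    unfolding power_mult_distrib[symmetric] K_def k_def by (simp only: mult.assoc)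
  also have "\<theta>\<^sup>2 * \<dots> * v \<le> 1 * v" using \<theta> pos by (intro mult_right_mono) auto
  finally have "2 * (\<theta>\<^sup>2 * K ^ k) \<le> v / h" using h by (simp add: field_simps)
  with main show ?thesis by simp
qed

section \<open>The threshold in terms of the normalised influence\<close>

lemma power_two_between:
  fixes x :: real
  assumes "1 \<le> x"
  shows "\<exists>L. x \<le> 2 ^ L \<and> 2 ^ L \<le> 2 * x"
proof -
  define L where "L = (LEAST L. x \<le> 2 ^ L)"
  have "\<exists>L. x \<le> 2 ^ L" using real_arch_pow[of 2 x] by (auto intro: less_imp_le)
  then have L: "x \<le> 2 ^ L" unfolding L_def by (rule LeastI_ex)
  have "2 ^ L \<le> 2 * x"
  proof (cases L)
    case 0
    then show ?thesis using assms by simp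
  next
    case (Suc l)
    then have "\<not> x \<le> 2 ^ l" using not_less_Least[of l "\<lambda>L. x \<le> 2 ^ L"] by (simp add: L_def)
    then show ?thesis using Suc by simp
  qed
  with L show ?thesis by blast
qed

text \<open>Take logarithms. From \<open>m <= 2 h t\<close> and
  \<open>ln m <= ln (2 h) + ln (1 + t)\<close>, the large power has logarithm at most a constant
  times \<open>t * ln (1 + t)\<close>; additive constants are absorbed because \<open>t >= 1\<close>
  makes \<open>ln (1 + t)\<close> at least \<open>ln 2\<close>. \<open>C\<close> is solved from this
  bound, the square of the threshold accounting for the factor 2 in
  \<open>m <= 2 h t\<close>.\<close>

lemma threshold_estimate:
  fixes A t m :: real and h L :: nat
  assumes A: "1 \<le> A" and h: "1 \<le> h" and t: "1 \<le> t" and m: "m = 2 ^ L" "m \<le> 2 * (real h * t)"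
  defines "C \<equiv> real h * ((ln A + 20 * ln (2 * real h)) / ln 2 + 20) / ln 2"
  shows "(2 powr (- (C * t * ln (1 + t))))\<^sup>2 * (A * m ^ 20) ^ (2 ^ L) \<le> 1"
proof -
  define l where "l = ln (1 + t)"
  define a where "a = ln A + 20 * ln (2 * real h)"
  have m1: "1 \<le> m" using m(1) by simp
  have l2: "ln 2 \<le> l" unfolding l_def using t by simp
  have ln2: "(0::real) < ln 2" by simp
  have a0: "0 \<le> a" using A h by (simp add: a_def)
  have "ln (A * m ^ 20) = ln A + 20 * ln m" using A m1 by (simp add: ln_mult ln_realpow)
  also have "\<dots> \<le> ln A + 20 * (ln (2 * real h) + l)"
  proof -
    have "m \<le> 2 * real h * t" using m(2) by (simp only: mult.assoc)
    moreover from this have "0 < 2 * real h * t" using m1 by linarith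
    ultimately have "ln m \<le> ln (2 * real h * t)" using m1 by (subst ln_le_cancel_iff) auto
    also have "\<dots> = ln (2 * real h) + ln t" using h t by (simp add: ln_mult)
    also have "ln t \<le> l" using t by (simp add: l_def)
    finally show ?thesis by simp
  qed
  also have "\<dots> = a + 20 * l" by (simp add: a_def)
  also have "a \<le> a / ln 2 * l"
    using l2 a0 ln2 by (simp add: field_simps mult_left_mono)
  finally have lnA: "ln (A * m ^ 20) \<le> (a / ln 2 + 20) * l" by (simp add: algebra_simps)
  have "m * ln (A * m ^ 20) \<le> (2 * (real h * t)) * ((a / ln 2 + 20) * l)"
  proof (rule mult_mono[OF m(2) lnA])
    have "1 * 1 \<le> A * m ^ 20" using A m1 by (intro mult_mono one_le_power) auto
    then show "0 \<le> ln (A * m ^ 20)" by simp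
  qed (use t in auto)
  also have "\<dots> = 2 * (C * t * l) * ln 2"
    using ln2 by (simp add: C_def a_def)
  finally have le: "m * ln (A * m ^ 20) \<le> 2 * (C * t * l) * ln 2" .
  have "(A * m ^ 20) ^ (2 ^ L) = exp (m * ln (A * m ^ 20))"
  proof -
    have "0 < A * m ^ 20" using A m1 by simp
    then have "(A * m ^ 20) ^ (2 ^ L) = exp (ln (A * m ^ 20)) ^ (2 ^ L)" by simp
    also have "\<dots> = exp (real (2 ^ L) * ln (A * m ^ 20))" by (rule exp_of_nat_mult[symmetric])
    finally show ?thesis by (simp add: m(1))
  qed
  moreover have "(2 powr (- (C * t * ln (1 + t))))\<^sup>2 = exp (- (2 * (C * t * l) * ln 2))"
    by (simp add: powr_def l_def power2_eq_square flip: exp_add)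
  ultimately show ?thesis using le by (simp flip: exp_add)
qed

section \<open>Transfer from the cube to the power set\<close>

definition point :: "nat \<Rightarrow> nat set \<Rightarrow> nat \<Rightarrow> nat" where
  "point n s = (\<lambda>i\<in>{1..n}. of_bool (i \<in> s))"

lemma bij_betw_point: "bij_betw (point n) (Pow {1..n}) (cube n)"
proof (rule bij_betwI[where g = "\<lambda>x. {i\<in>{1..n}. x i = 1}"])
  show "point n \<in> Pow {1..n} \<rightarrow> cube n" by (auto simp: point_def cube_def)
  show "(\<lambda>x. {i\<in>{1..n}. x i = 1}) \<in> cube n \<rightarrow> Pow {1..n}" by auto
  show "{i\<in>{1..n}. point n s i = 1} = s" if "s \<in> Pow {1..n}" for s
    using that by (auto simp: point_def)
  show "point n {i\<in>{1..n}. x i = 1} = x" if "x \<in> cube n" for x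
  proof
    fix i
    show "point n {i\<in>{1..n}. x i = 1} i = x i"
    proof (cases "i \<in> {1..n}")
      case True
      then have "x i \<in> {0, 1}" using that unfolding cube_def by (rule PiE_mem[rotated])
      then show ?thesis using True by (auto simp: point_def)
    next
      \<comment> \<open>Points of the cube are extensional: off the index set both sides are
        \<open>undefined\<close>.\<close>
      case False
      with that have "x i = undefined" unfolding cube_def by (blast intro: PiE_arb)
      then show ?thesis using False by (simp only: point_def restrict_def if_False)
    qed
  qed
qed

lemma expect_eq_avg: "expect n f = avg {1..n} (\<lambda>s. f (point n s))"
proof -
  have "(\<Sum>x\<in>cube n. f x) = (\<Sum>s\<in>Pow {1..n}. f (point n s))"
    by (rule sum.reindex_bij_betw[OF bij_betw_point, symmetric])
  moreover have "card (cube n) = 2 ^ n"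
    using bij_betw_same_card[OF bij_betw_point, of n] by (simp add: card_Pow)
  ultimately show ?thesis by (simp add: expect_def avg_def)
qed

lemma chi_point:
  assumes "S \<subseteq> {1..n}"
  shows "chi S (point n s) = walsh S s"
proof -
  have "finite S" using assms by (auto intro: finite_subset)
  have "(\<Sum>i\<in>S. point n s i) = (\<Sum>i\<in>S. of_bool (i \<in> s))"
    using assms by (intro sum.cong) (auto simp: point_def)
  also have "\<dots> = card (S \<inter> s)" using \<open>finite S\<close> by (simp add: of_bool_def sum.If_cases)
  finally show ?thesis by (simp add: chi_def walsh_def)
qed

lemma fourier_eq_coef:
  assumes "S \<subseteq> {1..n}"
  shows "fourier n f S = coef {1..n} (\<lambda>s. f (point n s)) S"
  by (simp add: fourier_def coef_def expect_eq_avg chi_point[OF assms])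

lemma variance_pos:
  assumes fin: "finite V" and "x \<subseteq> V" "y \<subseteq> V" "F x \<noteq> F y"
  shows "0 < avg V (\<lambda>x. (F x)\<^sup>2) - (avg V F)\<^sup>2"
proof -
  define p where "p = avg V F"
  have "avg V (\<lambda>x. (F x)\<^sup>2) - p\<^sup>2 = avg V (\<lambda>x. (F x)\<^sup>2 + (- 2 * p) * F x + p\<^sup>2)"
    unfolding avg_add avg_cmult avg_const[OF fin] p_def by (simp add: power2_eq_square)
  also have "\<dots> = avg V (\<lambda>x. (F x - p)\<^sup>2)"
    by (intro avg_cong) (simp add: power2_eq_square algebra_simps)
  finally have v: "avg V (\<lambda>x. (F x)\<^sup>2) - p\<^sup>2 = avg V (\<lambda>x. (F x - p)\<^sup>2)" .
  obtain z where z: "z \<in> Pow V" "F z \<noteq> p" using assms by (cases "F x = p") auto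
  have "0 < (\<Sum>x\<in>Pow V. (F x - p)\<^sup>2)"
    by (rule sum_pos2[OF _ z(1)]) (use z fin in auto)
  then have "0 < avg V (\<lambda>x. (F x - p)\<^sup>2)" by (simp add: avg_def)
  then show ?thesis using v by (simp add: p_def)
qed

text \<open>The Poincare inequality: a nonempty set has at least one element. It makes the
  normalised influence at least 1, as \<open>threshold_estimate\<close> requires.\<close>

lemma variance_le_influence:
  assumes fin: "finite V"
  shows "avg V (\<lambda>x. (F x)\<^sup>2) - (avg V F)\<^sup>2 \<le> (\<Sum>T\<in>Pow V. real (card T) * (coef V F T)\<^sup>2)"
proof -
  have "avg V (\<lambda>x. (F x)\<^sup>2) - (avg V F)\<^sup>2 = (\<Sum>T\<in>Pow V - {{}}. (coef V F T)\<^sup>2)"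
    using sum_Pow_nonempty[OF fin, of "\<lambda>T. (coef V F T)\<^sup>2"] by (simp add: parseval[OF fin] coef_empty)
  also have "\<dots> \<le> (\<Sum>T\<in>Pow V - {{}}. real (card T) * (coef V F T)\<^sup>2)"
  proof (rule sum_mono)
    fix T assume "T \<in> Pow V - {{}}"
    then have "finite T" "T \<noteq> {}" using fin by (auto intro: finite_subset)
    then have "1 \<le> card T" by (simp add: Suc_le_eq card_gt_0_iff)
    then have "1 * (coef V F T)\<^sup>2 \<le> real (card T) * (coef V F T)\<^sup>2" by (intro mult_right_mono) auto
    then show "(coef V F T)\<^sup>2 \<le> real (card T) * (coef V F T)\<^sup>2" by simp
  qed
  also have "\<dots> \<le> (\<Sum>T\<in>Pow V. real (card T) * (coef V F T)\<^sup>2)"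
    by (intro sum_mono2) (auto simp: fin)
  finally show ?thesis .
qed

theorem theorem1p2:
  shows "\<forall>\<eta>::real. \<eta> > 0 \<longrightarrow> (\<exists>C::real. C > 0 \<and>
    (\<forall>(n::nat) (f :: (nat \<Rightarrow> nat) \<Rightarrow> real).
      f \<in> cube n \<rightarrow> {0, 1} \<longrightarrow> \<not> f constant_on cube n \<longrightarrow>
      (\<Sum>S\<in>Pow {1..n}. (fourier n f S)\<^sup>2 *
         of_bool (\<bar>fourier n f S\<bar> \<le>
           2 powr (- (C * norm_influence n f * ln (1 + norm_influence n f)))))
      \<le> \<eta> * var n f))"
proof (intro allI impI)
  fix \<eta> :: real assume \<eta>: "0 < \<eta>"
  \<comment> \<open>The error obtained below is \<open>4 * v / h\<close>; the minimum 2 serves the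
    hypothesis of the variance bound.\<close>
  define h where "h = max 2 (nat \<lceil>4 / \<eta>\<rceil>)"
  have h2: "2 \<le> h" by (simp add: h_def)
  have "4 / \<eta> \<le> real (nat \<lceil>4 / \<eta>\<rceil>)" by (rule real_nat_ceiling_ge)
  also have "\<dots> \<le> real h" by (simp add: h_def)
  finally have "4 / \<eta> \<le> real h" .
  then have h\<eta>: "4 / real h \<le> \<eta>" using \<eta> h2 by (simp add: field_simps)
  define A where "A = 2 * real h * 2592 * 1327104 * (4 * real h) ^ 7"
  have "1 * 1 \<le> (2 * real h * 2592 * 1327104) * (4 * real h) ^ 7"
    using h2 by (intro mult_mono one_le_power) auto
  then have A: "1 \<le> A" by (simp add: A_def)
  define C where "C = real h * ((ln A + 20 * ln (2 * real h)) / ln 2 + 20) / ln 2"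
  have "0 \<le> (ln A + 20 * ln (2 * real h)) / ln 2" using A h2 by (intro divide_nonneg_pos) auto
  then have C: "0 < C" using h2 unfolding C_def by (intro divide_pos_pos mult_pos_pos) auto
  show "\<exists>C::real. C > 0 \<and> (\<forall>(n::nat) (f :: (nat \<Rightarrow> nat) \<Rightarrow> real).
      f \<in> cube n \<rightarrow> {0, 1} \<longrightarrow> \<not> f constant_on cube n \<longrightarrow>
      (\<Sum>S\<in>Pow {1..n}. (fourier n f S)\<^sup>2 *
         of_bool (\<bar>fourier n f S\<bar> \<le>
           2 powr (- (C * norm_influence n f * ln (1 + norm_influence n f)))))
      \<le> \<eta> * var n f)"
  proof (rule exI[of _ C], intro conjI allI impI C)
    fix n :: nat and f :: "(nat \<Rightarrow> nat) \<Rightarrow> real"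
    assume f: "f \<in> cube n \<rightarrow> {0, 1}" and nc: "\<not> f constant_on cube n"
    define V where "V = {1..n}"
    have fin: "finite V" by (simp add: V_def)
    define F where "F s = f (point n s)" for s
    define I where "I = (\<Sum>T\<in>Pow V. real (card T) * (coef V F T)\<^sup>2)"
    define v where "v = avg V (\<lambda>x. (F x)\<^sup>2) - (avg V F)\<^sup>2"
    define t where "t = I / v"
    have pc: "point n s \<in> cube n" if "s \<subseteq> V" for s
      using bij_betw_point[of n] that by (auto simp: V_def bij_betw_def)
    have F: "F x \<in> {0, 1}" if "x \<subseteq> V" for x unfolding F_def using f pc[OF that] by auto
    have coef: "fourier n f S = coef V F S" if "S \<in> Pow V" for S
      using fourier_eq_coef[of S n f] that by (simp add: V_def F_def[abs_def])
    have v: "var n f = v" by (simp add: var_def v_def expect_eq_avg V_def F_def[abs_def])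
    have t: "norm_influence n f = t"
      unfolding norm_influence_def v t_def total_influence_def I_def V_def[symmetric]
      by (intro arg_cong2[where f = "(/)"] sum.cong refl) (simp add: coef)
    obtain a b where ab: "a \<in> cube n" "b \<in> cube n" "f a \<noteq> f b"
      using nc unfolding constant_on_def by metis
    have "point n ` Pow V = cube n" using bij_betw_point[of n] by (simp add: V_def bij_betw_def)
    then obtain x y where "x \<subseteq> V" "y \<subseteq> V" "a = point n x" "b = point n y"
      using ab by (metis PowD imageE)
    then have v0: "0 < v" using ab(3) variance_pos[OF fin, of x y F] by (simp add: F_def v_def)
    have t1: "1 \<le> t" using variance_le_influence[OF fin, of F] v0 by (simp add: t_def v_def I_def)
    have "1 * 1 \<le> real h * t" using h2 t1 by (intro mult_mono) auto
    \<comment> \<open>The binary tree needs a power of two as the number of colours. The lower bound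
      feeds Markov's inequality, the upper bound the estimate of the threshold.\<close>
    then obtain L where L: "real h * t \<le> 2 ^ L" "2 ^ L \<le> 2 * (real h * t)"
      using power_two_between[of "real h * t"] by auto
    define \<theta> where "\<theta> = 2 powr (- (C * t * ln (1 + t)))"
    have \<theta>: "\<theta>\<^sup>2 * (A * (2 ^ L) ^ 20) ^ (2 ^ L) \<le> 1"
      unfolding \<theta>_def C_def by (rule threshold_estimate[OF A _ t1 refl L(2)]) (use h2 in simp)
    have "(\<Sum>S\<in>Pow V. (coef V F S)\<^sup>2 * of_bool (\<bar>coef V F S\<bar> \<le> \<theta>)) \<le> 4 * v / h"
    proof (rule small_coef_weight_boolean[OF fin h2 F v_def v0])
      show "real h * (\<Sum>T\<in>Pow V. real (card T) * (coef V F T)\<^sup>2) \<le> 2 ^ L * v"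
        using L(1) v0 by (simp add: t_def I_def field_simps)
      show "\<theta>\<^sup>2 * (2 * real h * 2592 * 1327104 * (4 * real h) ^ 7 * (2 ^ L) ^ 20) ^ (2 ^ L) \<le> 1"
        using \<theta> by (simp only: A_def)
    qed
    also have "\<dots> = (4 / h) * v" by simp
    also have "\<dots> \<le> \<eta> * v" using h\<eta> v0 by (intro mult_right_mono) auto
    finally have "(\<Sum>S\<in>Pow V. (coef V F S)\<^sup>2 * of_bool (\<bar>coef V F S\<bar> \<le> \<theta>)) \<le> \<eta> * v" .
    moreover have "(\<Sum>S\<in>Pow V. (fourier n f S)\<^sup>2 * of_bool (\<bar>fourier n f S\<bar> \<le> \<theta>)) =
      (\<Sum>S\<in>Pow V. (coef V F S)\<^sup>2 * of_bool (\<bar>coef V F S\<bar> \<le> \<theta>))"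
      by (rule sum.cong[OF refl]) (simp only: coef)
    ultimately show "(\<Sum>S\<in>Pow {1..n}. (fourier n f S)\<^sup>2 *
         of_bool (\<bar>fourier n f S\<bar> \<le>
           2 powr (- (C * norm_influence n f * ln (1 + norm_influence n f)))))
      \<le> \<eta> * var n f"
      unfolding v t V_def[symmetric] \<theta>_def[symmetric] by (simp only:)
  qed
qed

end
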